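(* For every reduced plane curve germ $C=\bigcup_{k=1}^rC_k\subset(\mathbb{C}^2,0)$ with $r$ irreducible components, the power series $\overline{P}_g(t_1,\ldots,t_r)$ (the reduced motivic Poincaré series of $C$) is a polynomial in the variables $t_1,\ldots,t_r$ and $q$.
   Context: Let $\gamma_k:(\mathbb{C},0)\to(C_k,0)$ be uniformizations of the components, $\mathcal{O}=\mathcal{O}_{\mathbb{C}^2,0}$, $v_k(f)=\mathrm{ord}_0 f(\gamma_k(t))$, and for $\underline v\in\mathbb{Z}^r$ let $J_{\underline v}=\{f\in\mathcal{O}: v_k(f)\ge v_k \ \forall k\}$, $h(\underline v)=\dim_{\mathbb{C}}\mathcal{O}/J_{\underline v}$. Let $q$ be a formal variable (corresponding to $\mathbb{L}^{-1}$). Put $L_g=\sum_{\underline v\in\mathbb{Z}^r}\frac{q^{h(\underline v)}-q^{h(\underline v+\underline 1)}}{1-q}t_1^{v_1}\cdots t_r^{v_r}$ and $$P_g(t_1,\dots,t_r)=\frac{L_g\cdot\prod_{k=1}^r(t_k-1)}{t_1\cdots t_r-1}$$ (the product in the numerator is taken coefficientwise and is a power series). Equivalently, the coefficient of $t^{\underline v}$, $\underline v\in\mathbb{Z}_{\ge0}^r$, in $P_g$ is $\frac1{1-q}\sum_{J\subset\{1,\dots,r\}}(-1)^{|J|}q^{h(\underline v+e_J)}$, $e_J=\sum_{k\in J}e_k$; this is the motivic integral $\int_{\mathbb{P}\mathcal{O}}t_1^{v_1}\cdots t_r^{v_r}d\mu$. The reduced motivic Poincaré series is $\overline{P}_g=P_g\cdot\prod_{k=1}^r(1-qt_k)$.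 *)

theory Defs
  imports
    "HOL-Analysis.Analysis"
    "HOL-Computational_Algebra.Computational_Algebra"
    "HOL-Library.Function_Algebras"
    "HOL-Library.Poly_Mapping"
begin

unbundle no vec_syntax

section \<open>The local ring of convergent power series in two variables\<close>

text \<open>
  A formal power series in \<open>x\<close>, \<open>y\<close> is a power series in \<open>x\<close> whose coefficients are power series
  in \<open>y\<close>; \<open>f $ i $ j\<close> is the coefficient of \<open>x\<^sup>i y\<^sup>j\<close>.  Germs at the origin of holomorphic functions
  of two variables are identified with their Taylor series.
\<close>

definition conv2 :: "complex fps fps \<Rightarrow> bool" where
  "conv2 f \<longleftrightarrow> (\<exists>\<rho>>0. (\<lambda>(i, j). norm (f $ i $ j) * \<rho> ^ (i + j)) summable_on UNIV)"

lemma conv2_iff_bound: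
  "conv2 f \<longleftrightarrow> (\<exists>M R. 0 < R \<and> (\<forall>i j. norm (f $ i $ j) \<le> M * R ^ (i + j)))"
proof
  assume "conv2 f"
  then obtain \<rho> where \<rho>: "\<rho> > 0"
    and s: "(\<lambda>(i, j). norm (f $ i $ j) * \<rho> ^ (i + j)) summable_on (UNIV :: (nat \<times> nat) set)"
    unfolding conv2_def by auto
  define M where "M = infsum (\<lambda>(i, j). norm (f $ i $ j) * \<rho> ^ (i + j)) (UNIV :: (nat \<times> nat) set)"
  have "norm (f $ i $ j) \<le> M * (1 / \<rho>) ^ (i + j)" for i j
  proof -
    have "infsum (\<lambda>(i, j). norm (f $ i $ j) * \<rho> ^ (i + j)) {(i, j)} \<le> M"
      unfolding M_def using s \<rho> by (intro infsum_mono_neutral) auto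
    then show ?thesis using \<rho> by (simp add: power_divide field_simps)
  qed
  then show "\<exists>M R. 0 < R \<and> (\<forall>i j. norm (f $ i $ j) \<le> M * R ^ (i + j))"
    using \<rho> by (intro exI[of _ M] exI[of _ "1 / \<rho>"]) auto
next
  assume "\<exists>M R. 0 < R \<and> (\<forall>i j. norm (f $ i $ j) \<le> M * R ^ (i + j))"
  then obtain M R where R: "0 < R" and b: "\<And>i j. norm (f $ i $ j) \<le> M * R ^ (i + j)" by blast
  define \<rho> where "\<rho> = 1 / (2 * R)"
  have \<rho>: "\<rho> > 0" using R by (simp add: \<rho>_def)
  have g: "(\<lambda>i. (1 / 2 :: real) ^ i) summable_on (UNIV :: nat set)"
    by (rule summable_nonneg_imp_summable_on) (auto intro: summable_geometric)
  have "(\<lambda>(i, j). (1 / 2 :: real) ^ i * (1 / 2) ^ j) summable_on (UNIV :: nat set) \<times> (UNIV :: nat set)"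
    by (rule summable_on_SigmaI[where g = "\<lambda>i. (1 / 2 :: real) ^ i * infsum (\<lambda>j. (1 / 2) ^ j) UNIV"])
      (use g in \<open>auto intro!: has_sum_cmult_right summable_on_cmult_left\<close>)
  then have "(\<lambda>p. M * (case p of (i, j) \<Rightarrow> (1 / 2 :: real) ^ i * (1 / 2) ^ j)) summable_on UNIV"
    by (intro summable_on_cmult_right) simp
  then have "(\<lambda>(i, j). norm (f $ i $ j) * \<rho> ^ (i + j)) summable_on UNIV"
  proof (rule summable_on_comparison_test, goal_cases)
    case (1 p)
    obtain i j where p: "p = (i, j)" by (cases p)
    have "norm (f $ i $ j) * \<rho> ^ (i + j) \<le> M * R ^ (i + j) * \<rho> ^ (i + j)"
      using b[of i j] \<rho> by (intro mult_right_mono) auto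
    also have "\<dots> = M * (R * \<rho>) ^ (i + j)" by (simp add: power_mult_distrib)
    also have "R * \<rho> = 1 / 2" using R by (simp add: \<rho>_def)
    finally show ?case by (simp add: p power_add)
  next
    case (2 p)
    show ?case using \<rho> by (cases p) simp
  qed
  then show "conv2 f" unfolding conv2_def using \<rho> by blast
qed

lemma conv2_obtain:
  assumes "conv2 f"
  obtains M R where "0 \<le> M" "1 \<le> R"
    "\<And>S i j. R \<le> S \<Longrightarrow> norm (f $ i $ j) \<le> M * S ^ (i + j)"
proof -
  from assms obtain M R where R: "0 < R" and b: "\<And>i j. norm (f $ i $ j) \<le> M * R ^ (i + j)"
    unfolding conv2_iff_bound by blast
  have M: "0 \<le> M" using b[of 0 0] norm_ge_zero[of "f $ 0 $ 0"] by (simp del: norm_ge_zero)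
  show thesis
  proof (rule that[of M "max 1 R"])
    fix S i j assume S: "max 1 R \<le> S"
    have "M * R ^ (i + j) \<le> M * S ^ (i + j)"
      using S R M by (intro mult_left_mono power_mono) auto
    with b[of i j] show "norm (f $ i $ j) \<le> M * S ^ (i + j)" by linarith
  qed (use M in auto)
qed

lemma conv2_const: "conv2 (fps_const (fps_const c))"
  unfolding conv2_iff_bound
  by (intro exI[of _ "norm c"] exI[of _ 1]) simp

lemma conv2_uminus: "conv2 f \<Longrightarrow> conv2 (- f)"
  unfolding conv2_def by simp

lemma conv2_add:
  assumes "conv2 f" "conv2 g"
  shows "conv2 (f + g)"
proof -
  obtain M R where f: "0 \<le> M" "1 \<le> R" "\<And>S i j. R \<le> S \<Longrightarrow> norm (f $ i $ j) \<le> M * S ^ (i + j)"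
    using conv2_obtain[OF assms(1)] by metis
  obtain N T where g: "0 \<le> N" "1 \<le> T" "\<And>S i j. T \<le> S \<Longrightarrow> norm (g $ i $ j) \<le> N * S ^ (i + j)"
    using conv2_obtain[OF assms(2)] by metis
  have "norm ((f + g) $ i $ j) \<le> (M + N) * (max R T) ^ (i + j)" for i j
    using f(3)[of "max R T" i j] g(3)[of "max R T" i j]
      norm_triangle_ineq[of "f $ i $ j" "g $ i $ j"]
    by (simp add: algebra_simps)
  then show ?thesis unfolding conv2_iff_bound using f(2)
    by (intro exI[of _ "M + N"] exI[of _ "max R T"]) auto
qed

lemma conv2_mult:
  assumes "conv2 f" "conv2 g"
  shows "conv2 (f * g)"
proof -
  obtain M R where f: "0 \<le> M" "1 \<le> R" "\<And>S i j. R \<le> S \<Longrightarrow> norm (f $ i $ j) \<le> M * S ^ (i + j)"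
    using conv2_obtain[OF assms(1)] by metis
  obtain N T where g: "0 \<le> N" "1 \<le> T" "\<And>S i j. T \<le> S \<Longrightarrow> norm (g $ i $ j) \<le> N * S ^ (i + j)"
    using conv2_obtain[OF assms(2)] by metis
  define S where "S = max R T"
  have S: "1 \<le> S" using f(2) by (auto simp: S_def)
  have pow: "real (Suc n) \<le> 2 ^ n" for n
    by (induction n) auto
  have "norm ((f * g) $ i $ j) \<le> (M * N) * (2 * S) ^ (i + j)" for i j
  proof -
    have "(f * g) $ i $ j = (\<Sum>a=0..i. \<Sum>b=0..j. f $ a $ b * g $ (i - a) $ (j - b))"
      by (simp add: fps_mult_nth fps_sum_nth)
    also have "norm \<dots> \<le> (\<Sum>a=0..i. \<Sum>b=0..j. norm (f $ a $ b * g $ (i - a) $ (j - b)))"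
      by (intro order_trans[OF norm_sum] sum_mono order.refl)
    also have "\<dots> \<le> (\<Sum>a=0..i. \<Sum>b=0..j. M * N * S ^ (i + j))"
    proof (intro sum_mono)
      fix a b assume ab: "a \<in> {0..i}" "b \<in> {0..j}"
      have "norm (f $ a $ b * g $ (i - a) $ (j - b))
          \<le> (M * S ^ (a + b)) * (N * S ^ (i - a + (j - b)))"
        unfolding norm_mult using f g S by (intro mult_mono) (auto simp: S_def)
      also have "\<dots> = M * N * S ^ (a + b + (i - a + (j - b)))"
        by (simp add: power_add mult_ac)
      also have "a + b + (i - a + (j - b)) = i + j" using ab by auto
      finally show "norm (f $ a $ b * g $ (i - a) $ (j - b)) \<le> M * N * S ^ (i + j)" .
    qed
    also have "\<dots> = (real (Suc i) * real (Suc j)) * (M * N * S ^ (i + j))" by simp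
    also have "\<dots> \<le> (2 ^ i * 2 ^ j) * (M * N * S ^ (i + j))"
      using pow[of i] pow[of j] f(1) g(1) S by (intro mult_right_mono mult_mono) auto
    also have "\<dots> = (M * N) * (2 * S) ^ (i + j)"
      by (simp add: power_mult_distrib power_add mult_ac)
    finally show ?thesis .
  qed
  then show ?thesis unfolding conv2_iff_bound using S
    by (intro exI[of _ "M * N"] exI[of _ "2 * S"]) auto
qed

typedef germ = "{f. conv2 f}"
  morphisms series Germ
  using conv2_const[of 0] by blast

setup_lifting type_definition_germ

instantiation germ :: idom
begin

lift_definition zero_germ :: germ is 0
  using conv2_const[of 0] by simp
lift_definition one_germ :: germ is 1
  using conv2_const[of 1] by simp
lift_definition plus_germ :: "germ \<Rightarrow> germ \<Rightarrow> germ" is "(+)"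
  by (rule conv2_add)
lift_definition times_germ :: "germ \<Rightarrow> germ \<Rightarrow> germ" is "(*)"
  by (rule conv2_mult)
lift_definition uminus_germ :: "germ \<Rightarrow> germ" is uminus
  by (rule conv2_uminus)
lift_definition minus_germ :: "germ \<Rightarrow> germ \<Rightarrow> germ" is "(-)"
  using conv2_add conv2_uminus by fastforce

instance
  by standard (transfer; simp add: algebra_simps)+

end

lift_definition germ_const :: "complex \<Rightarrow> germ" is "\<lambda>c. fps_const (fps_const c)"
  by (rule conv2_const)

definition germ_scale :: "complex \<Rightarrow> germ \<Rightarrow> germ" where
  "germ_scale c f = germ_const c * f"

definition germ_domain :: "germ \<Rightarrow> (complex \<times> complex) set" where
  "germ_domain f = {(x, y). (\<lambda>(i, j). series f $ i $ j * x ^ i * y ^ j) summable_on UNIV}"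

definition germ_eval :: "germ \<Rightarrow> complex \<times> complex \<Rightarrow> complex" where
  "germ_eval f = (\<lambda>(x, y). \<Sum>\<^sub>\<infinity>(i, j). series f $ i $ j * x ^ i * y ^ j)"

section \<open>Dimension of a quotient vector space\<close>

global_interpretation germ: vector_space germ_scale
  unfolding germ_scale_def
  by unfold_locales (transfer; simp add: algebra_simps flip: fps_const_add fps_const_mult)+

text \<open>\<open>quotient_basis W B\<close>: the classes of the elements of \<open>B\<close> are pairwise distinct and form a
  basis of the quotient of the ring of germs by the subspace \<open>W\<close>.\<close>

definition quotient_basis :: "germ set \<Rightarrow> germ set \<Rightarrow> bool" where
  "quotient_basis W B \<longleftrightarrow>
     (\<forall>S c. finite S \<longrightarrow> S \<subseteq> B \<longrightarrow> (\<Sum>b\<in>S. germ_scale (c b) b) \<in> W \<longrightarrow> (\<forall>b\<in>S. c b = 0)) \<and>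
     (\<forall>f. \<exists>S c. finite S \<and> S \<subseteq> B \<and> f - (\<Sum>b\<in>S. germ_scale (c b) b) \<in> W)"

definition quotient_dim :: "germ set \<Rightarrow> nat" where
  "quotient_dim W = card (SOME B. quotient_basis W B)"

section \<open>Branches and valuations\<close>

text \<open>A germ of a holomorphic arc is given by the Taylor series of its two coordinates.\<close>

type_synonym arc = "complex fps \<times> complex fps"

definition arc_eval :: "arc \<Rightarrow> complex \<Rightarrow> complex \<times> complex" where
  "arc_eval \<gamma> t = (eval_fps (fst \<gamma>) t, eval_fps (snd \<gamma>) t)"

text \<open>
  \<open>uniformization g \<gamma>\<close>: the germ \<open>\<gamma>\<close> is holomorphic with \<open>\<gamma>(0) = 0\<close> and maps a neighbourhood of \<open>0\<close>
  homeomorphically onto a neighbourhood of the origin in the curve \<open>g = 0\<close>.  Being holomorphic, it is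
  then biholomorphic outside the origin.
\<close>

definition uniformization :: "germ \<Rightarrow> arc \<Rightarrow> bool" where
  "uniformization g \<gamma> \<longleftrightarrow>
     fps_conv_radius (fst \<gamma>) > 0 \<and> fps_conv_radius (snd \<gamma>) > 0 \<and>
     fst \<gamma> $ 0 = 0 \<and> snd \<gamma> $ 0 = 0 \<and>
     (\<exists>U V \<delta>. open U \<and> 0 \<in> U \<and>
        U \<subseteq> eball 0 (fps_conv_radius (fst \<gamma>)) \<inter> eball 0 (fps_conv_radius (snd \<gamma>)) \<and>
        open V \<and> (0, 0) \<in> V \<and> V \<subseteq> germ_domain g \<and>
        homeomorphism U {p \<in> V. germ_eval g p = 0} (arc_eval \<gamma>) \<delta>)"

text \<open>
  The Taylor series of \<open>f(\<gamma>(t))\<close>.  As \<open>\<gamma>(0) = 0\<close>, the product \<open>x(t)\<^sup>i y(t)\<^sup>j\<close> has order at least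
  \<open>i + j\<close>, so only \<open>i, j \<le> n\<close> contribute to the coefficient of \<open>t\<^sup>n\<close>.
\<close>

definition pullback :: "arc \<Rightarrow> germ \<Rightarrow> complex fps" where
  "pullback \<gamma> f =
     Abs_fps (\<lambda>n. \<Sum>i\<le>n. \<Sum>j\<le>n. series f $ i $ j * (fst \<gamma> ^ i * snd \<gamma> ^ j) $ n)"

definition valuation :: "arc \<Rightarrow> germ \<Rightarrow> enat" where
  "valuation \<gamma> f = (if pullback \<gamma> f = 0 then \<infinity> else enat (subdegree (pullback \<gamma> f)))"

text \<open>Orders are nonnegative, so replacing a negative bound by \<open>0\<close> does not change the condition.\<close>

definition J_ideal :: "('r \<Rightarrow> arc) \<Rightarrow> ('r \<Rightarrow> int) \<Rightarrow> germ set" where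
  "J_ideal \<gamma> v = {f. \<forall>k. enat (nat (v k)) \<le> valuation (\<gamma> k) f}"

definition codim_fun :: "('r \<Rightarrow> arc) \<Rightarrow> ('r \<Rightarrow> int) \<Rightarrow> nat" where
  "codim_fun \<gamma> v = quotient_dim (J_ideal \<gamma> v)"

section \<open>Multivariate Laurent series\<close>

text \<open>
  Variables are indexed by \<open>'r\<close>; coefficients are power series in \<open>q\<close>.  A series infinite in all
  directions is its coefficient function; such series form a module over the Laurent polynomials,
  with action \<open>laurent_mult\<close>.
\<close>

type_synonym 'r laurent_poly = "('r \<Rightarrow> int) \<Rightarrow>\<^sub>0 rat fps"
type_synonym 'r laurent_series = "('r \<Rightarrow> int) \<Rightarrow> rat fps"

abbreviation qvar :: "rat fps" where "qvar \<equiv> fps_X"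

definition unit_vec :: "'r \<Rightarrow> 'r \<Rightarrow> int" where
  "unit_vec k = (\<lambda>i. if i = k then 1 else 0)"

definition tvar :: "'r \<Rightarrow> 'r laurent_poly" where
  "tvar k = Poly_Mapping.single (unit_vec k) 1"

definition coeff_const :: "rat fps \<Rightarrow> 'r laurent_poly" where
  "coeff_const c = Poly_Mapping.single 0 c"

definition laurent_mult :: "'r laurent_poly \<Rightarrow> 'r laurent_series \<Rightarrow> 'r laurent_series" where
  "laurent_mult p A v = (\<Sum>u\<in>Poly_Mapping.keys p. Poly_Mapping.lookup p u * A (v - u))"

lemma laurent_mult_superset:
  assumes "finite S" "Poly_Mapping.keys p \<subseteq> S"
  shows "laurent_mult p A v = (\<Sum>u\<in>S. Poly_Mapping.lookup p u * A (v - u))"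
  unfolding laurent_mult_def using assms
  by (intro sum.mono_neutral_left) (auto simp: in_keys_iff)

lemma laurent_mult_single:
  "laurent_mult (Poly_Mapping.single u c) A v = c * A (v - u)"
  using laurent_mult_superset[of "{u}" "Poly_Mapping.single u c" A v] by (simp split: if_splits)

lemma laurent_mult_1 [simp]: "laurent_mult 1 A = A"
  by (rule ext) (simp add: laurent_mult_single flip: single_one)

lemma laurent_mult_0 [simp]: "laurent_mult 0 A = 0"
  by (rule ext) (simp add: laurent_mult_def)

lemma laurent_mult_add_left:
  "laurent_mult (p + p') A = laurent_mult p A + laurent_mult p' A"
proof (rule ext)
  fix v
  let ?S = "Poly_Mapping.keys p \<union> Poly_Mapping.keys p'"
  have "laurent_mult (p + p') A v = (\<Sum>u\<in>?S. Poly_Mapping.lookup (p + p') u * A (v - u))"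
    by (rule laurent_mult_superset) (use Poly_Mapping.keys_add[of p p'] in auto)
  also have "\<dots> = (\<Sum>u\<in>?S. Poly_Mapping.lookup p u * A (v - u))
      + (\<Sum>u\<in>?S. Poly_Mapping.lookup p' u * A (v - u))"
    by (simp add: lookup_add algebra_simps sum.distrib)
  also have "\<dots> = laurent_mult p A v + laurent_mult p' A v"
    by (subst (1 2) laurent_mult_superset[of ?S]) auto
  finally show "laurent_mult (p + p') A v = (laurent_mult p A + laurent_mult p' A) v" by simp
qed

lemma laurent_mult_diff_left:
  "laurent_mult (p - p') A = laurent_mult p A - laurent_mult p' A"
  using laurent_mult_add_left[of "p - p'" p' A] by (simp add: algebra_simps)

lemma laurent_mult_sum_left:
  "laurent_mult (\<Sum>i\<in>I. p i) A v = (\<Sum>i\<in>I. laurent_mult (p i) A v)"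
  by (induction I rule: infinite_finite_induct) (simp_all add: laurent_mult_add_left)

lemma laurent_mult_add_right:
  "laurent_mult p (A + B) = laurent_mult p A + laurent_mult p B"
  by (rule ext) (simp add: laurent_mult_def algebra_simps sum.distrib)

lemma laurent_poly_induct [case_names zero single_add]:
  assumes "P 0" "\<And>u c p. P p \<Longrightarrow> P (Poly_Mapping.single u c + p)"
  shows "P (p :: 'r laurent_poly)"
proof (induction p rule: update_induct)
  case const
  show ?case by (rule assms(1))
next
  case (update p u c)
  have "Poly_Mapping.update u c p = Poly_Mapping.single u c + p"
    using update(1) by (intro poly_mapping_eqI) (auto simp: lookup_update lookup_add lookup_single in_keys_iff)
  with update show ?case using assms(2) by simp
qed

lemma laurent_mult_single_assoc:
  "laurent_mult (Poly_Mapping.single u c * p) A = laurent_mult (Poly_Mapping.single u c) (laurent_mult p A)"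
proof (induction p rule: laurent_poly_induct)
  case zero
  show ?case by (rule ext) (simp add: laurent_mult_single)
next
  case (single_add w d p)
  have "laurent_mult (Poly_Mapping.single u c * Poly_Mapping.single w d) A
      = laurent_mult (Poly_Mapping.single u c) (laurent_mult (Poly_Mapping.single w d) A)"
    by (rule ext) (simp add: mult_single laurent_mult_single algebra_simps)
  with single_add show ?case
    by (simp only: distrib_left laurent_mult_add_left laurent_mult_add_right)
qed

lemma laurent_mult_assoc: "laurent_mult (p * p') A = laurent_mult p (laurent_mult p' A)"
  by (induction p rule: laurent_poly_induct)
    (simp_all add: distrib_right laurent_mult_add_left laurent_mult_single_assoc)

lemma prod_single:
  fixes u :: "'i \<Rightarrow> 'r \<Rightarrow> int"
  assumes "finite S"
  shows "(\<Prod>k\<in>S. Poly_Mapping.single (u k) 1)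
    = (Poly_Mapping.single (\<Sum>k\<in>S. u k) 1 :: 'r laurent_poly)"
  using assms
proof (induction S rule: finite_induct)
  case empty
  show ?case by (simp only: prod.empty sum.empty single_one)
next
  case (insert k S)
  then show ?case
    by (simp only: prod.insert[OF insert(1,2)] sum.insert[OF insert(1,2)] mult_single mult_1_left)
qed

lemma prod_tvar:
  assumes "finite S"
  shows "(\<Prod>k\<in>S. tvar k) = Poly_Mapping.single (\<Sum>k\<in>S. unit_vec k) 1"
  unfolding tvar_def by (rule prod_single[OF assms])

lemma prod_tvar_inverse:
  assumes "finite S"
  shows "(\<Prod>k\<in>S. Poly_Mapping.single (- unit_vec k) 1)
     = (Poly_Mapping.single (- (\<Sum>k\<in>S. unit_vec k)) 1 :: 'r laurent_poly)"
  using prod_single[OF assms, of "\<lambda>k. - unit_vec k"] by (simp only: sum_negf)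

lemma sum_unit_vec: "(\<Sum>k\<in>UNIV. unit_vec k) = (1 :: 'r::finite \<Rightarrow> int)"
proof
  fix i :: 'r
  have "(\<Sum>k\<in>S. unit_vec k) i = (\<Sum>k\<in>S. unit_vec k i)" if "finite S" for S :: "'r set"
    using that by (induction S rule: finite_induct) auto
  then show "(\<Sum>k\<in>UNIV. unit_vec k) i = (1 :: 'r \<Rightarrow> int) i"
    by (simp add: unit_vec_def)
qed

definition is_power_series :: "'r laurent_series \<Rightarrow> bool" where
  "is_power_series A \<longleftrightarrow> (\<forall>v. A v \<noteq> 0 \<longrightarrow> (\<forall>k. 0 \<le> v k))"

definition is_polynomial :: "'r laurent_series \<Rightarrow> bool" where
  "is_polynomial A \<longleftrightarrow> is_power_series A \<and> finite {v. A v \<noteq> 0} \<and>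
     (\<forall>v. \<exists>p :: int poly. A v = fps_of_poly (map_poly rat_of_int p))"

section \<open>The motivic Poincare series\<close>

definition L_series :: "('r \<Rightarrow> arc) \<Rightarrow> 'r laurent_series" where
  "L_series \<gamma> v = (qvar ^ codim_fun \<gamma> v - qvar ^ codim_fun \<gamma> (v + 1)) / (1 - qvar)"

definition poincare_series :: "('r::finite \<Rightarrow> arc) \<Rightarrow> 'r laurent_series" where
  "poincare_series \<gamma> = (THE P. is_power_series P \<and>
     laurent_mult ((\<Prod>k\<in>UNIV. tvar k) - 1) P = laurent_mult (\<Prod>k\<in>UNIV. tvar k - 1) (L_series \<gamma>))"

text \<open>The division defining \<open>poincare_series\<close> is possible, with a unique result; its coefficients are
  alternating sums.\<close>

lemma poincare_series_unique:
  fixes P Q :: "'r::finite laurent_series"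
  assumes "is_power_series P" "is_power_series Q"
    and "laurent_mult ((\<Prod>k\<in>UNIV. tvar k) - 1) P = laurent_mult ((\<Prod>k\<in>UNIV. tvar k) - 1) Q"
  shows "P = Q"
proof
  fix v :: "'r \<Rightarrow> int"
  define D where "D = (\<lambda>v. P v - Q v)"
  have "laurent_mult ((\<Prod>k\<in>UNIV. tvar k) - 1) A v = A (v - 1) - A v" for A :: "'r laurent_series" and v
    by (simp add: laurent_mult_diff_left prod_tvar laurent_mult_single sum_unit_vec)
  with assms(3) have "P (v - 1) - P v = Q (v - 1) - Q v" for v
    by metis
  then have step: "D (v - 1) = D v" for v
    by (simp add: D_def algebra_simps)
  have iter: "D (\<lambda>k. v k - int n) = D v" for n
  proof (induction n)
    case (Suc n)
    have "(\<lambda>k. v k - int (Suc n)) = (\<lambda>k. v k - int n) - 1" by (auto simp: fun_eq_iff)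
    with Suc step show ?case by simp
  qed simp
  obtain k :: 'r where True by blast
  have neg: "\<not> 0 \<le> v k - int (nat (v k + 1))" by auto
  have "D (\<lambda>k'. v k' - int (nat (v k + 1))) = 0"
    using assms(1,2) neg unfolding is_power_series_def D_def
    by (metis (no_types, lifting) diff_0_right)
  then show "P v = Q v" using iter[of "nat (v k + 1)"] by (simp add: D_def)
qed

lemma codim_fun_add_unit_vec:
  assumes "v k < 0"
  shows "codim_fun \<gamma> (v + unit_vec k) = codim_fun \<gamma> v"
proof -
  have "nat ((v + unit_vec k) i) = nat (v i)" for i
    using assms by (auto simp: unit_vec_def)
  then have "J_ideal \<gamma> (v + unit_vec k) = J_ideal \<gamma> v"
    by (simp add: J_ideal_def del: plus_fun_apply)
  then show ?thesis by (simp add: codim_fun_def)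
qed

lemma
  fixes \<gamma> :: "'r::finite \<Rightarrow> arc"
  shows poincare_series_is_power_series: "is_power_series (poincare_series \<gamma>)"
    and poincare_series_eq:
      "laurent_mult ((\<Prod>k\<in>UNIV. tvar k) - 1) (poincare_series \<gamma>)
         = laurent_mult (\<Prod>k\<in>UNIV. tvar k - 1) (L_series \<gamma>)"
    and poincare_series_nth: "poincare_series \<gamma> v
      = (\<Sum>J\<in>UNIV. (- 1) ^ card J * qvar ^ codim_fun \<gamma> (v + (\<Sum>k\<in>J. unit_vec k))) / (1 - qvar)"
proof -
  define T :: "'r laurent_poly" where "T = (\<Prod>k\<in>UNIV. tvar k)"
  define s :: "'r \<Rightarrow> 'r laurent_poly" where "s = (\<lambda>k. Poly_Mapping.single (- unit_vec k) 1)"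
  define S where "S = (\<Prod>k\<in>UNIV. s k)"
  define H :: "'r laurent_series" where "H = (\<lambda>v. qvar ^ codim_fun \<gamma> v / (1 - qvar))"
  define P where "P = laurent_mult (\<Prod>k\<in>UNIV. 1 - s k) H"
  have ts: "tvar k * s k = 1" for k
    by (simp add: tvar_def s_def mult_single)
  have unit: "is_unit (1 - qvar :: rat fps)" by (simp add: fps_is_unit_iff)
  have div_diff: "(a - b) / (1 - qvar) = a / (1 - qvar) - b / (1 - qvar)" for a b :: "rat fps"
    using unit by (simp add: fps_divide_unit left_diff_distrib)
  have L: "L_series \<gamma> = laurent_mult (1 - S) H"
    by (rule ext) (simp add: S_def s_def prod_tvar_inverse laurent_mult_diff_left laurent_mult_single
        sum_unit_vec L_series_def H_def div_diff)
  have TS: "T * S = 1"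
    by (simp add: T_def S_def ts flip: prod.distrib)
  have Ts: "T * (\<Prod>k\<in>UNIV. 1 - s k) = (\<Prod>k\<in>UNIV. tvar k - 1)"
    by (simp add: T_def ts right_diff_distrib flip: prod.distrib)
  have "(T - 1) * (\<Prod>k\<in>UNIV. 1 - s k) = (T * (1 - S)) * (\<Prod>k\<in>UNIV. 1 - s k)"
    using TS by (simp add: right_diff_distrib)
  also have "\<dots> = (\<Prod>k\<in>UNIV. tvar k - 1) * (1 - S)"
    unfolding Ts[symmetric] by (simp add: mult_ac)
  finally have eq: "laurent_mult (T - 1) P = laurent_mult (\<Prod>k\<in>UNIV. tvar k - 1) (L_series \<gamma>)"
    unfolding P_def L by (simp flip: laurent_mult_assoc)
  have mono: "(\<Prod>k\<in>J. s k) = Poly_Mapping.single (- (\<Sum>k\<in>J. unit_vec k)) 1" for J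
    unfolding s_def by (rule prod_tvar_inverse) simp
  have sgn: "(- 1) ^ n * Poly_Mapping.single u 1 = (Poly_Mapping.single u ((- 1) ^ n) :: 'r laurent_poly)" for n u
    by (induction n) (simp_all add: single_uminus)
  have nth: "P v = (\<Sum>J\<in>UNIV. (- 1) ^ card J * H (v + (\<Sum>k\<in>J. unit_vec k)))" for v
    unfolding P_def
    by (simp add: prod_diff_conv_sum mono sgn laurent_mult_sum_left laurent_mult_single)
  have "P v = 0" if "v k < 0" for v k
  proof -
    let ?R = "UNIV - {k}"
    let ?f = "\<lambda>J. (- 1) ^ card J * H (v + (\<Sum>k\<in>J. unit_vec k))"
    have "Pow (insert k ?R) = Pow ?R \<union> insert k ` Pow ?R" by (rule Pow_insert)
    then have U: "(UNIV :: 'r set set) = Pow ?R \<union> insert k ` Pow ?R"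
      by (simp add: insert_absorb)
    have "P v = (\<Sum>J\<in>Pow ?R. ?f J) + (\<Sum>J\<in>insert k ` Pow ?R. ?f J)"
      unfolding nth by (subst U, intro sum.union_disjoint) auto
    also have "(\<Sum>J\<in>insert k ` Pow ?R. ?f J) = (\<Sum>J\<in>Pow ?R. ?f (insert k J))"
      by (subst sum.reindex) (auto intro!: inj_onI simp: o_def)
    also have "\<dots> = (\<Sum>J\<in>Pow ?R. - ?f J)"
    proof (intro sum.cong refl)
      fix J assume J: "J \<in> Pow ?R"
      have zero: "(\<Sum>k\<in>J. unit_vec k) k = 0" if "finite J" "k \<notin> J" for J
        using that by (induction J rule: finite_induct) (auto simp: unit_vec_def)
      have "(\<Sum>k\<in>J. unit_vec k) k = 0" by (rule zero) (use J in auto)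
      then have "(v + (\<Sum>k\<in>J. unit_vec k)) k < 0" using \<open>v k < 0\<close> by simp
      then have "H (v + (\<Sum>k\<in>J. unit_vec k) + unit_vec k) = H (v + (\<Sum>k\<in>J. unit_vec k))"
        unfolding H_def by (subst codim_fun_add_unit_vec) auto
      moreover have "k \<notin> J" using J by auto
      ultimately show "?f (insert k J) = - ?f J"
        by (simp add: add_ac)
    qed
    finally show ?thesis by (simp only: sum_negf add.right_inverse)
  qed
  then have ps: "is_power_series P" unfolding is_power_series_def by (metis not_le)
  have P: "poincare_series \<gamma> = P" unfolding poincare_series_def
    by (rule the_equality, use ps eq in \<open>simp add: T_def\<close>,
      rule poincare_series_unique, use ps eq in \<open>auto simp: T_def\<close>)
  show "is_power_series (poincare_series \<gamma>)"
    using ps P by simp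
  show "laurent_mult ((\<Prod>k\<in>UNIV. tvar k) - 1) (poincare_series \<gamma>)
      = laurent_mult (\<Prod>k\<in>UNIV. tvar k - 1) (L_series \<gamma>)"
    using eq P by (simp add: T_def)
  show "poincare_series \<gamma> v
      = (\<Sum>J\<in>UNIV. (- 1) ^ card J * qvar ^ codim_fun \<gamma> (v + (\<Sum>k\<in>J. unit_vec k))) / (1 - qvar)"
    using unit by (simp add: P nth H_def fps_divide_unit sum_distrib_right mult.assoc)
qed

definition reduced_poincare_series :: "('r::finite \<Rightarrow> arc) \<Rightarrow> 'r laurent_series" where
  "reduced_poincare_series \<gamma> =
     laurent_mult (\<Prod>k\<in>UNIV. 1 - coeff_const qvar * tvar k) (poincare_series \<gamma>)"

end

theory Submission
  imports Defs "HOL-Complex_Analysis.Laurent_Convergence"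
begin

unbundle no vec_syntax

text \<open>
  Let \<open>h(v)\<close> be the codimension of \<open>J_ideal \<gamma> v\<close>, and let \<open>H\<close> be the series with coefficients
  \<open>q^h(v) / (1 - q)\<close>.  The alternating sum that gives a coefficient of the Poincare series says that
  this series is \<open>\<Prod>k. (1 - 1/t_k)\<close> applied to \<open>H\<close>; hence the reduced series is
  \<open>\<Prod>k. (1 - q t_k) (1 - 1/t_k)\<close> applied to \<open>H\<close>, and all these factors commute.

  Suppose that for every \<open>k\<close> there is a bound \<open>c_k\<close> such that \<open>h(v + e_k) = h(v) + 1\<close> as soon as
  \<open>v_k \<ge> c_k\<close>, whatever the other coordinates of \<open>v\<close> are.  Then \<open>(1 - q t_k) H\<close> has no terms with
  \<open>v_k > c_k\<close>, and no other factor can create such terms.  In the same way \<open>(1 - 1/t_k) H\<close> has no terms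
  with \<open>v_k < 0\<close>, because \<open>h(v + e_k) = h(v)\<close> there.  So the reduced series has finite support, and each
  coefficient is an integer polynomial in \<open>q\<close>, because \<open>1 - q\<close> divides \<open>q^m - q^n\<close>
  (\<open>reduced_poincare_series_polynomial\<close>).

  The bound \<open>c_k\<close> is a conductor statement.  The step \<open>h(v + e_k) = h(v) + 1\<close> holds if some germ has order
  exactly \<open>v_k\<close> on the branch \<open>k\<close> and vanishes on all the other branches.  Such a germ is the product
  of two factors:

  \<^item> the product of the \<open>F j\<close> with \<open>j \<noteq> k\<close>.  It vanishes on the other branches
    (\<open>uniformization_pullback_eq_0\<close>), and it has finite order on the branch \<open>k\<close>: all germs
    vanishing on a branch have a common divisor \<open>Q\<close> that is not a unit
    (\<open>vanishing_germs_common_divisor\<close>), so if \<open>F j\<close> also vanished on the branch \<open>k\<close>, then \<open>Q\<^sup>2\<close> would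
    divide \<open>F j * F k\<close>, against squarefreeness;
  \<^item> a germ of prescribed order on the branch \<open>k\<close>, which exists for all large orders
    (\<open>arc_orders_cofinite\<close>).

  Both results on a single branch \<open>\<gamma> = (x, y)\<close> come from its injectivity.  After a change of parameter
  that turns a given series of order \<open>n\<close> into \<open>s^n\<close>, the rotations \<open>s \<mapsto> \<zeta> s\<close> with \<open>\<zeta>^n = 1\<close> act, and no
  nontrivial one may fix both coordinates.  If all orders were multiples of some \<open>d > 1\<close>, then a quotient of order
  \<open>d\<close> would become \<open>s^d\<close>, every pullback would be a series in \<open>s^d\<close>, and a rotation of order \<open>d\<close> would
  fix \<open>\<gamma>\<close>.  If \<open>x = s^n\<close>, then the \<open>n\<close> rotated copies of \<open>y\<close> are distinct, the polynomial \<open>Q\<close> in \<open>Y\<close> with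
  these roots has coefficients that are convergent series in \<open>s^n = x\<close>, and Weierstrass division of a germ vanishing
  on \<open>\<gamma>\<close> by \<open>Q\<close> leaves a remainder of degree less than \<open>n\<close> with \<open>n\<close> roots, that is, no remainder.
\<close>

section \<open>From the growth of the Hilbert function to polynomiality\<close>

text \<open>
  The principle behind all three parts of the polynomiality proof: a property of series that survives
  each factor survives their product, so a single well-chosen factor can be applied first to establish it.
\<close>

lemma laurent_mult_prod_preserves:
  assumes "finite T" and "\<And>j A. j \<in> T \<Longrightarrow> Pr A \<Longrightarrow> Pr (laurent_mult (p j) A)" and "Pr A"
  shows "Pr (laurent_mult (\<Prod>j\<in>T. p j) A)"
  using assms
proof (induction T rule: finite_induct)
  case (insert j T)
  then show ?case by (simp add: laurent_mult_assoc)
qed simp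

abbreviation shift_back :: "'r \<Rightarrow> 'r laurent_poly" where
  "shift_back k \<equiv> Poly_Mapping.single (- unit_vec k) 1"

abbreviation hilbert_series :: "('r \<Rightarrow> arc) \<Rightarrow> 'r laurent_series" where
  "hilbert_series \<gamma> \<equiv> \<lambda>v. qvar ^ codim_fun \<gamma> v / (1 - qvar)"

lemma laurent_mult_one_minus_shift_back:
  "laurent_mult (1 - shift_back k) A v = A v - A (v + unit_vec k)"
  by (simp add: laurent_mult_diff_left laurent_mult_single)

lemma laurent_mult_one_minus_q_tvar:
  "laurent_mult (1 - coeff_const qvar * tvar k) A v = A v - qvar * A (v - unit_vec k)"
  by (simp add: laurent_mult_diff_left coeff_const_def tvar_def mult_single laurent_mult_single)

lemma poincare_series_conv_prod:
  fixes \<gamma> :: "'r::finite \<Rightarrow> arc"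
  shows "poincare_series \<gamma> = laurent_mult (\<Prod>k\<in>UNIV. 1 - shift_back k) (hilbert_series \<gamma>)"
proof
  fix v
  have unit: "is_unit (1 - qvar :: rat fps)" by (simp add: fps_is_unit_iff)
  have mono: "(\<Prod>k\<in>J. shift_back k)
      = (Poly_Mapping.single (- (\<Sum>k\<in>J. unit_vec k)) 1 :: 'r laurent_poly)" for J :: "'r set"
    by (rule prod_tvar_inverse) simp
  have sgn: "(- 1) ^ n * Poly_Mapping.single u 1 = (Poly_Mapping.single u ((- 1) ^ n) :: 'r laurent_poly)"
    for n u
    by (induction n) (simp_all add: single_uminus)
  show "poincare_series \<gamma> v = laurent_mult (\<Prod>k\<in>UNIV. 1 - shift_back k) (hilbert_series \<gamma>) v"
    unfolding poincare_series_nth using unit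
    by (simp add: prod_diff_conv_sum mono sgn laurent_mult_sum_left laurent_mult_single
        fps_divide_unit sum_distrib_right mult.assoc)
qed

lemma reduced_poincare_series_conv_prod:
  fixes \<gamma> :: "'r::finite \<Rightarrow> arc"
  shows "reduced_poincare_series \<gamma> = laurent_mult (\<Prod>k\<in>UNIV. 1 - coeff_const qvar * tvar k)
    (laurent_mult (\<Prod>k\<in>UNIV. 1 - shift_back k) (hilbert_series \<gamma>))"
  by (simp add: reduced_poincare_series_def poincare_series_conv_prod)

definition int_poly_coeffs :: "rat fps set" where
  "int_poly_coeffs = range (\<lambda>p :: int poly. fps_of_poly (map_poly rat_of_int p))"

lemma int_poly_coeffs_diff: "a \<in> int_poly_coeffs \<Longrightarrow> b \<in> int_poly_coeffs \<Longrightarrow> a - b \<in> int_poly_coeffs"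
proof -
  assume "a \<in> int_poly_coeffs" "b \<in> int_poly_coeffs"
  then obtain p r where "a = fps_of_poly (map_poly rat_of_int p)" "b = fps_of_poly (map_poly rat_of_int r)"
    unfolding int_poly_coeffs_def by blast
  then have "a - b = fps_of_poly (map_poly rat_of_int (p - r))"
    by (simp add: fps_eq_iff coeff_map_poly)
  then show ?thesis unfolding int_poly_coeffs_def by blast
qed

lemma int_poly_coeffs_qvar_mult: "a \<in> int_poly_coeffs \<Longrightarrow> qvar * a \<in> int_poly_coeffs"
proof -
  assume "a \<in> int_poly_coeffs"
  then obtain p where p: "a = fps_of_poly (map_poly rat_of_int p)"
    unfolding int_poly_coeffs_def by blast
  have "qvar * a = fps_of_poly (map_poly rat_of_int (pCons 0 p))"
    by (auto simp: p fps_eq_iff coeff_map_poly coeff_pCons split: nat.splits)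
  then show ?thesis unfolding int_poly_coeffs_def by blast
qed

lemma int_poly_coeffs_power_diff_div: "(qvar ^ m - qvar ^ n) / (1 - qvar) \<in> int_poly_coeffs"
proof -
  have unit: "is_unit (1 - qvar :: rat fps)" by (simp add: fps_is_unit_iff)
  have geo: "(1 - qvar ^ n) / (1 - qvar) \<in> int_poly_coeffs" for n
  proof -
    have "(1 - qvar ^ n) / (1 - qvar) = (\<Sum>i<n. qvar ^ i :: rat fps)"
      using unit by (simp add: one_diff_power_eq)
    also have "\<dots> = fps_of_poly (map_poly rat_of_int (\<Sum>i<n. monom 1 i))"
      by (simp add: fps_eq_iff coeff_map_poly fps_sum_nth coeff_sum)
    finally show ?thesis unfolding int_poly_coeffs_def by blast
  qed
  have "(qvar ^ m - qvar ^ n) / (1 - qvar) = (1 - qvar ^ n) / (1 - qvar) - (1 - qvar ^ m) / (1 - qvar :: rat fps)"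
    using unit by (simp add: fps_divide_unit algebra_simps)
  with geo int_poly_coeffs_diff show ?thesis by metis
qed

text \<open>
  Of the two factors belonging to the variable \<open>t_k\<close>, \<open>1 - 1/t_k\<close> kills the terms with negative exponent
  of \<open>t_k\<close> and makes the coefficients polynomial, and \<open>1 - q t_k\<close> kills the terms beyond \<open>c k\<close>.  As the
  factors commute, the relevant one is always applied first.
\<close>

theorem reduced_poincare_series_polynomial:
  fixes \<gamma> :: "'r::finite \<Rightarrow> arc"
  assumes step: "\<And>k v. c k \<le> v k \<Longrightarrow> codim_fun \<gamma> (v + unit_vec k) = codim_fun \<gamma> v + 1"
  shows "is_polynomial (reduced_poincare_series \<gamma>)"
proof -
  define H where "H = hilbert_series \<gamma>"
  define a :: "'r \<Rightarrow> 'r laurent_poly" where "a = (\<lambda>k. 1 - coeff_const qvar * tvar k)"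
  define b :: "'r \<Rightarrow> 'r laurent_poly" where "b = (\<lambda>k. 1 - shift_back k)"
  have unit: "is_unit (1 - qvar :: rat fps)" by (simp add: fps_is_unit_iff)
  have eq: "reduced_poincare_series \<gamma> = laurent_mult ((\<Prod>k\<in>UNIV. a k) * (\<Prod>k\<in>UNIV. b k)) H"
    unfolding reduced_poincare_series_conv_prod a_def b_def H_def by (simp add: laurent_mult_assoc)
  have a: "laurent_mult (a k) A v = A v - qvar * A (v - unit_vec k)" for k A v
    by (simp add: a_def laurent_mult_one_minus_q_tvar)
  have b: "laurent_mult (b k) A v = A v - A (v + unit_vec k)" for k A v
    by (simp add: b_def laurent_mult_one_minus_shift_back)
  have split: "(\<Prod>k\<in>UNIV. f k) = (\<Prod>k\<in>UNIV - {k}. f k) * f k" for f :: "'r \<Rightarrow> 'r laurent_poly" and k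
    by (simp add: prod.remove[of UNIV k] mult.commute)
  have nonneg: "0 \<le> unit_vec j i" for j i :: 'r by (simp add: unit_vec_def)
  have a_low: "laurent_mult (a j) A w = 0" if "\<forall>w. w k < 0 \<longrightarrow> A w = 0" "w k < 0" for j k A w
  proof -
    have "(w - unit_vec j) k < 0" using that(2) nonneg[of j k] by simp
    with that show ?thesis unfolding a by (metis diff_0_right mult_zero_right)
  qed
  have b_high: "laurent_mult (b j) A w = 0" if "\<forall>w. c k < w k \<longrightarrow> A w = 0" "c k < w k" for j k A w
  proof -
    have "c k < (w + unit_vec j) k" using that(2) nonneg[of j k] by simp
    with that show ?thesis unfolding b by (metis diff_0_right)
  qed
  have low: "reduced_poincare_series \<gamma> v = 0" if v: "v k < 0" for v k
  proof -
    have "laurent_mult (b k) H w = 0" if "w k < 0" for w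
      using codim_fun_add_unit_vec[of w k \<gamma>] that by (simp add: b H_def)
    then have "\<forall>w. w k < 0 \<longrightarrow> laurent_mult (\<Prod>j\<in>UNIV-{k}. b j) (laurent_mult (b k) H) w = 0"
      by - (rule laurent_mult_prod_preserves[where Pr = "\<lambda>A. \<forall>w. w k < 0 \<longrightarrow> A w = 0"],
        auto simp: b unit_vec_def)
    then have "\<forall>w. w k < 0 \<longrightarrow> laurent_mult (\<Prod>j\<in>UNIV. b j) H w = 0"
      by (simp add: split[of b k] laurent_mult_assoc)
    then have "\<forall>w. w k < 0 \<longrightarrow> laurent_mult (\<Prod>j\<in>UNIV. a j) (laurent_mult (\<Prod>j\<in>UNIV. b j) H) w = 0"
      by - (rule laurent_mult_prod_preserves[where Pr = "\<lambda>A. \<forall>w. w k < 0 \<longrightarrow> A w = 0"],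
        auto intro: a_low)
    with v show ?thesis by (simp add: eq laurent_mult_assoc)
  qed
  have high: "reduced_poincare_series \<gamma> v = 0" if v: "c k < v k" for v k
  proof -
    have "laurent_mult (a k) H w = 0" if "c k < w k" for w
    proof -
      have "c k \<le> (w - unit_vec k) k" using that by (simp add: unit_vec_def)
      with step[of k "w - unit_vec k"]
      have "codim_fun \<gamma> w = codim_fun \<gamma> (w - unit_vec k) + 1" by simp
      then show ?thesis using unit by (simp add: a H_def fps_divide_unit mult.assoc)
    qed
    then have "\<forall>w. c k < w k \<longrightarrow> laurent_mult (\<Prod>j\<in>UNIV-{k}. a j) (laurent_mult (a k) H) w = 0"
      by - (rule laurent_mult_prod_preserves[where Pr = "\<lambda>A. \<forall>w. c k < w k \<longrightarrow> A w = 0"],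
        auto simp: a unit_vec_def)
    then have "\<forall>w. c k < w k \<longrightarrow> laurent_mult (\<Prod>j\<in>UNIV. a j) H w = 0"
      by (simp add: split[of a k] laurent_mult_assoc)
    then have "\<forall>w. c k < w k \<longrightarrow> laurent_mult (\<Prod>j\<in>UNIV. b j) (laurent_mult (\<Prod>j\<in>UNIV. a j) H) w = 0"
      by - (rule laurent_mult_prod_preserves[where Pr = "\<lambda>A. \<forall>w. c k < w k \<longrightarrow> A w = 0"],
        auto intro: b_high)
    then show ?thesis using v unfolding eq by (subst mult.commute) (simp add: laurent_mult_assoc)
  qed
  have "finite {v. reduced_poincare_series \<gamma> v \<noteq> 0}"
  proof (rule finite_subset)
    show "{v. reduced_poincare_series \<gamma> v \<noteq> 0} \<subseteq> (\<Pi>\<^sub>E k\<in>UNIV. {0..c k})"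
      using low high by (force simp: PiE_def Pi_def not_less[symmetric])
  qed (auto intro!: finite_PiE)
  moreover have "is_power_series (reduced_poincare_series \<gamma>)"
    unfolding is_power_series_def using low by (metis not_le)
  moreover have "\<forall>v. reduced_poincare_series \<gamma> v \<in> int_poly_coeffs"
  proof -
    fix k :: 'r
    have "\<forall>v. laurent_mult (b k) H v \<in> int_poly_coeffs"
    proof
      fix v
      have "laurent_mult (b k) H v
          = (qvar ^ codim_fun \<gamma> v - qvar ^ codim_fun \<gamma> (v + unit_vec k)) / (1 - qvar)"
        using unit by (simp add: b H_def fps_divide_unit left_diff_distrib)
      then show "laurent_mult (b k) H v \<in> int_poly_coeffs"
        by (simp only: int_poly_coeffs_power_diff_div)
    qed
    then have "\<forall>v. laurent_mult (\<Prod>j\<in>UNIV-{k}. b j) (laurent_mult (b k) H) v \<in> int_poly_coeffs"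
      by - (rule laurent_mult_prod_preserves[where Pr = "\<lambda>A. \<forall>v. A v \<in> int_poly_coeffs"],
        auto simp: b int_poly_coeffs_diff)
    then have "\<forall>v. laurent_mult (\<Prod>j\<in>UNIV. b j) H v \<in> int_poly_coeffs"
      by (simp add: split[of b k] laurent_mult_assoc)
    then have "\<forall>v. laurent_mult (\<Prod>j\<in>UNIV. a j) (laurent_mult (\<Prod>j\<in>UNIV. b j) H) v \<in> int_poly_coeffs"
      by - (rule laurent_mult_prod_preserves[where Pr = "\<lambda>A. \<forall>v. A v \<in> int_poly_coeffs"],
        auto simp: a int_poly_coeffs_diff int_poly_coeffs_qvar_mult)
    then show ?thesis by (simp add: eq laurent_mult_assoc)
  qed
  ultimately show ?thesis
    unfolding is_polynomial_def int_poly_coeffs_def by blast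
qed

section \<open>Dimensions of quotients\<close>

text \<open>
  Projecting \<open>C\<close> into the span of \<open>B\<close> along \<open>W\<close> keeps it independent, so the exchange lemma applies.
\<close>

lemma quotient_basis_card_le:
  assumes "quotient_basis W B" "quotient_basis W C" "finite B" "germ.subspace W"
  shows "finite C \<and> card C \<le> card B"
proof -
  have "\<exists>p\<in>germ.span B. f - p \<in> W" for f
  proof -
    obtain S c where "S \<subseteq> B" "f - (\<Sum>b\<in>S. germ_scale (c b) b) \<in> W"
      using assms(1) unfolding quotient_basis_def by blast
    moreover have "(\<Sum>b\<in>S. germ_scale (c b) b) \<in> germ.span B"
      using \<open>S \<subseteq> B\<close> by (intro germ.span_sum germ.span_scale germ.span_base) auto
    ultimately show ?thesis by blast
  qed
  then obtain p where p: "\<And>f. p f \<in> germ.span B" "\<And>f. f - p f \<in> W" by metis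
  have comb: "\<forall>b\<in>S. c b = 0"
    if S: "finite S" "S \<subseteq> C" and "(\<Sum>b\<in>S. germ_scale (c b) (p b)) \<in> W" for S c
  proof -
    have "(\<Sum>b\<in>S. germ_scale (c b) (b - p b)) \<in> W"
      using assms(4) p(2) by (intro germ.subspace_sum germ.subspace_scale) auto
    then have "(\<Sum>b\<in>S. germ_scale (c b) (p b)) + (\<Sum>b\<in>S. germ_scale (c b) (b - p b)) \<in> W"
      using that assms(4) germ.subspace_add by blast
    also have "(\<Sum>b\<in>S. germ_scale (c b) (p b)) + (\<Sum>b\<in>S. germ_scale (c b) (b - p b))
        = (\<Sum>b\<in>S. germ_scale (c b) b)"
      by (simp add: germ.scale_right_diff_distrib flip: sum.distrib)
    finally show ?thesis using assms(2) S unfolding quotient_basis_def by blast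
  qed
  have W0: "0 \<in> W" using assms(4) by (rule germ.subspace_0)
  have inj: "inj_on p C"
  proof (rule inj_onI, rule ccontr)
    fix x y assume xy: "x \<in> C" "y \<in> C" "p x = p y" "x \<noteq> y"
    have "\<forall>b\<in>{x, y}. (if b = x then 1 else -1) = (0 :: complex)"
      by (rule comb) (use xy W0 in auto)
    then show False by simp
  qed
  have "germ.independent (p ` C)"
    unfolding germ.independent_explicit_finite_subsets
  proof (intro allI impI)
    fix S u assume S: "S \<subseteq> p ` C" "finite S" and eq: "(\<Sum>v\<in>S. germ_scale (u v) v) = 0"
    obtain T where T: "T \<subseteq> C" "finite T" "S = p ` T"
      using S by (meson finite_subset_image)
    have "(\<Sum>b\<in>T. germ_scale (u (p b)) (p b)) = 0"
      using eq inj T by (simp add: sum.reindex inj_on_subset)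
    with comb[of T "\<lambda>b. u (p b)"] T W0 show "\<forall>v\<in>S. u v = 0" by auto
  qed
  then have "finite (p ` C) \<and> card (p ` C) \<le> card B"
    by (rule germ.independent_span_bound[OF assms(3)]) (use p in auto)
  then show ?thesis using inj by (simp add: card_image finite_image_iff)
qed

text \<open>
  The choice in the definition of \<open>quotient_dim\<close> is harmless: any finite quotient basis has the chosen cardinality.
\<close>

lemma quotient_dim_eq_card:
  assumes "quotient_basis W B" "finite B" "germ.subspace W"
  shows "quotient_dim W = card B"
proof -
  have some: "quotient_basis W (SOME B. quotient_basis W B)"
    using assms(1) by (rule someI)
  from quotient_basis_card_le[OF assms(1) this assms(2,3)]
    quotient_basis_card_le[OF this assms(1) _ assms(3)]
  show ?thesis unfolding quotient_dim_def by auto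
qed

lemma quotient_basis_insert:
  assumes B: "quotient_basis W B" and W: "germ.subspace W" "germ.subspace W'" and "W' \<subseteq> W"
    and g: "g \<in> W" "g \<notin> W'" and line: "\<And>f. f \<in> W \<Longrightarrow> \<exists>c. f - germ_scale c g \<in> W'"
  shows "quotient_basis W' (insert g B)" and "g \<notin> B"
proof -
  have ind: "\<And>S c. finite S \<Longrightarrow> S \<subseteq> B \<Longrightarrow> (\<Sum>b\<in>S. germ_scale (c b) b) \<in> W \<Longrightarrow> \<forall>b\<in>S. c b = 0"
    and span: "\<And>f. \<exists>S c. finite S \<and> S \<subseteq> B \<and> f - (\<Sum>b\<in>S. germ_scale (c b) b) \<in> W"
    using B unfolding quotient_basis_def by blast+
  show gB: "g \<notin> B"
    using ind[of "{g}" "\<lambda>_. 1"] g by auto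
  have "\<forall>b\<in>S. c b = 0"
    if S: "finite S" "S \<subseteq> insert g B" and sum: "(\<Sum>b\<in>S. germ_scale (c b) b) \<in> W'" for S c
  proof -
    define T where "T = S - {g}"
    define e where "e = (if g \<in> S then c g else 0)"
    have T: "finite T" "T \<subseteq> B" using S by (auto simp: T_def)
    have eq: "(\<Sum>b\<in>S. germ_scale (c b) b) = germ_scale e g + (\<Sum>b\<in>T. germ_scale (c b) b)"
      using S by (auto simp: T_def e_def sum.remove)
    have "(\<Sum>b\<in>S. germ_scale (c b) b) - germ_scale e g \<in> W"
      using sum g W assms(4) by (intro germ.subspace_diff germ.subspace_scale) auto
    then have "(\<Sum>b\<in>T. germ_scale (c b) b) \<in> W" by (simp add: eq)
    with ind T have c: "\<forall>b\<in>T. c b = 0" by blast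
    then have e: "germ_scale e g \<in> W'" using sum eq by simp
    have "e = 0"
    proof (rule ccontr)
      assume "e \<noteq> 0"
      then have "germ_scale (1 / e) (germ_scale e g) = g" by simp
      with e W g show False using germ.subspace_scale by metis
    qed
    with c show ?thesis by (auto simp: T_def e_def split: if_splits)
  qed
  moreover have "\<exists>S c. finite S \<and> S \<subseteq> insert g B \<and> f - (\<Sum>b\<in>S. germ_scale (c b) b) \<in> W'" for f
  proof -
    obtain S c where S: "finite S" "S \<subseteq> B" "f - (\<Sum>b\<in>S. germ_scale (c b) b) \<in> W"
      using span by blast
    then obtain e where e: "f - (\<Sum>b\<in>S. germ_scale (c b) b) - germ_scale e g \<in> W'"
      using line by blast
    have "g \<notin> S" using S gB by auto
    then have "(\<Sum>b\<in>S. germ_scale ((c(g := e)) b) b) = (\<Sum>b\<in>S. germ_scale (c b) b)"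
      by (intro sum.cong) auto
    then have "f - (\<Sum>b\<in>insert g S. germ_scale ((c(g := e)) b) b) \<in> W'"
      using S e \<open>g \<notin> S\<close> by (simp add: algebra_simps)
    then show ?thesis using S by (intro exI[of _ "insert g S"] exI) auto
  qed
  ultimately show "quotient_basis W' (insert g B)"
    unfolding quotient_basis_def by blast
qed

lemma quotient_basis_UNIV: "quotient_basis UNIV {}"
  unfolding quotient_basis_def by auto

section \<open>Substituting an arc into a germ\<close>

lemma fps_mult_low_nth_zero:
  fixes a b :: "'a::comm_ring_1 fps"
  assumes "\<And>i. i < m \<Longrightarrow> a $ i = 0" "\<And>i. i < n \<Longrightarrow> b $ i = 0" "k < m + n"
  shows "(a * b) $ k = 0"
proof -
  have "a $ i * b $ (k - i) = 0" if "i \<le> k" for i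
    using assms that by (cases "i < m") auto
  then show ?thesis by (simp add: fps_mult_nth)
qed

lemma fps_power_low_nth_zero:
  fixes x :: "'a::comm_ring_1 fps"
  assumes "x $ 0 = 0" "k < n"
  shows "(x ^ n) $ k = 0"
  using startsby_zero_power_prefix[OF assms(1), of n] assms(2) by auto


text \<open>
  The value at \<open>x\<close> of a power series whose coefficients are themselves power series in the parameter of the
  arc.  For \<open>x\<close> without constant term only the terms with \<open>i \<le> n\<close> reach the coefficient \<open>n\<close>.
\<close>

definition fps_subst_outer :: "'a::comm_ring_1 fps \<Rightarrow> 'a fps fps \<Rightarrow> 'a fps" where
  "fps_subst_outer x F = Abs_fps (\<lambda>n. \<Sum>i\<le>n. (F $ i * x ^ i) $ n)"

lemma fps_subst_outer_nth:
  assumes "x $ 0 = 0" "n \<le> N"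
  shows "fps_subst_outer x F $ n = (\<Sum>i\<le>N. (F $ i * x ^ i) $ n)"
proof -
  have "(F $ i * x ^ i) $ n = 0" if "n < i" for i
    using fps_mult_low_nth_zero[of 0 "F $ i" i "x ^ i" n] fps_power_low_nth_zero[OF assms(1), of _ i] that
    by simp
  then show ?thesis
    unfolding fps_subst_outer_def fps_nth_Abs_fps using assms(2)
    by (intro sum.mono_neutral_left) (simp_all add: not_le)
qed

lemma fps_subst_outer_add:
  "fps_subst_outer x (F + G) = fps_subst_outer x F + fps_subst_outer x G"
  by (simp add: fps_eq_iff fps_subst_outer_def algebra_simps sum.distrib)

lemma fps_subst_outer_mult:
  assumes x: "x $ 0 = 0"
  shows "fps_subst_outer x (F * G) = fps_subst_outer x F * fps_subst_outer x G"
proof (rule fps_ext)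
  fix n
  define T where "T = (\<lambda>i j. (F $ i * G $ j * x ^ (i + j)) $ n)"
  have T0: "T i j = 0" if "n < i + j" for i j
    unfolding T_def
    using fps_mult_low_nth_zero[of 0 "F $ i * G $ j" "i + j" "x ^ (i + j)" n]
      fps_power_low_nth_zero[OF x, of _ "i + j"] that by simp
  have "(fps_subst_outer x F * fps_subst_outer x G) $ n
      = (\<Sum>k=0..n. (\<Sum>i\<le>n. (F $ i * x ^ i) $ k) * (\<Sum>j\<le>n. (G $ j * x ^ j) $ (n - k)))"
    by (simp add: fps_mult_nth fps_subst_outer_nth[OF x, of _ n])
  also have "\<dots> = (\<Sum>i\<le>n. \<Sum>j\<le>n. \<Sum>k=0..n. (F $ i * x ^ i) $ k * (G $ j * x ^ j) $ (n - k))"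
    by (simp only: sum_product) (subst sum.swap, rule sum.cong[OF refl], subst sum.swap, rule refl)
  also have "\<dots> = (\<Sum>i\<le>n. \<Sum>j\<le>n. T i j)"
    by (simp add: T_def power_add mult_ac flip: fps_mult_nth)
  also have "\<dots> = (\<Sum>(i, j)\<in>{..n} \<times> {..n}. T i j)"
    by (simp add: sum.cartesian_product)
  also have "\<dots> = (\<Sum>(i, j)\<in>{(i, j). i + j \<le> n}. T i j)"
    using T0 by (intro sum.mono_neutral_right) (auto, metis not_le)
  also have "\<dots> = (\<Sum>m\<le>n. \<Sum>i\<le>m. T i (m - i))"
    by (rule sum.triangle_reindex_eq)
  also have "\<dots> = fps_subst_outer x (F * G) $ n"
    unfolding fps_subst_outer_def
    by (simp add: fps_mult_nth[of F G] sum_distrib_right fps_sum_nth T_def atMost_atLeast0)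
  finally show "fps_subst_outer x (F * G) $ n = (fps_subst_outer x F * fps_subst_outer x G) $ n" ..
qed

lemma fps_compose_nth_upto:
  fixes f :: "'a::comm_ring_1 fps"
  assumes "t $ 0 = 0" "n \<le> N"
  shows "(f oo t) $ n = (\<Sum>i\<le>N. f $ i * (t ^ i) $ n)"
  unfolding fps_compose_nth using assms fps_power_low_nth_zero[OF assms(1)]
  by (auto intro!: sum.mono_neutral_left)

lemma fps_subst_outer_compose:
  fixes x :: "'a::idom fps"
  assumes x: "x $ 0 = 0" and t: "t $ 0 = 0"
  shows "fps_subst_outer x F oo t = fps_subst_outer (x oo t) (Abs_fps (\<lambda>i. F $ i oo t))"
proof (rule fps_ext)
  fix n
  have "(fps_subst_outer x F oo t) $ n = (\<Sum>k\<le>n. \<Sum>i\<le>n. (F $ i * x ^ i) $ k * (t ^ k) $ n)"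
    by (simp add: fps_compose_nth_upto[OF t order.refl] fps_subst_outer_nth[OF x, of _ n] sum_distrib_right)
  also have "\<dots> = (\<Sum>i\<le>n. ((F $ i * x ^ i) oo t) $ n)"
    by (subst sum.swap) (simp add: fps_compose_nth_upto[OF t order.refl])
  also have "\<dots> = fps_subst_outer (x oo t) (Abs_fps (\<lambda>i. F $ i oo t)) $ n"
    using t by (simp add: fps_subst_outer_def fps_compose_mult_distrib fps_compose_power)
  finally show "(fps_subst_outer x F oo t) $ n = \<dots>" .
qed


text \<open>
  The pullback of a formal double series, obtained by substituting one variable at a time.  In this form the
  multiplicativity of the pullback follows from that of composition.
\<close>

definition fps_subst2 :: "arc \<Rightarrow> complex fps fps \<Rightarrow> complex fps" where
  "fps_subst2 \<gamma> F = fps_subst_outer (fst \<gamma>) (Abs_fps (\<lambda>i. F $ i oo snd \<gamma>))"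

definition centered_arc :: "arc \<Rightarrow> bool" where
  "centered_arc \<gamma> \<longleftrightarrow> fst \<gamma> $ 0 = 0 \<and> snd \<gamma> $ 0 = 0"

lemma pullback_eq_fps_subst2:
  assumes "centered_arc \<gamma>"
  shows "pullback \<gamma> f = fps_subst2 \<gamma> (series f)"
proof (rule fps_ext)
  fix n
  have y: "snd \<gamma> $ 0 = 0" using assms by (simp add: centered_arc_def)
  have "((series f $ i oo snd \<gamma>) * fst \<gamma> ^ i) $ n
      = (\<Sum>j\<le>n. series f $ i $ j * (fst \<gamma> ^ i * snd \<gamma> ^ j) $ n)" for i
  proof -
    have "((series f $ i oo snd \<gamma>) * fst \<gamma> ^ i) $ n
        = (\<Sum>k=0..n. \<Sum>j\<le>n. series f $ i $ j * (snd \<gamma> ^ j) $ k * (fst \<gamma> ^ i) $ (n - k))"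
      by (simp add: fps_mult_nth fps_compose_nth_upto[OF y, of _ n] sum_distrib_right)
    also have "\<dots> = (\<Sum>j\<le>n. series f $ i $ j * (snd \<gamma> ^ j * fst \<gamma> ^ i) $ n)"
      by (subst sum.swap) (simp add: fps_mult_nth sum_distrib_left mult.assoc)
    finally show ?thesis by (simp add: mult.commute)
  qed
  then show "pullback \<gamma> f $ n = fps_subst2 \<gamma> (series f) $ n"
    by (simp add: pullback_def fps_subst2_def fps_subst_outer_def)
qed

lemma fps_subst2_add: "fps_subst2 \<gamma> (F + G) = fps_subst2 \<gamma> F + fps_subst2 \<gamma> G"
  unfolding fps_subst2_def fps_subst_outer_add[symmetric]
  by (rule arg_cong[where f = "fps_subst_outer (fst \<gamma>)"]) (simp add: fps_eq_iff fps_compose_add_distrib)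

lemma fps_subst2_mult:
  assumes "centered_arc \<gamma>"
  shows "fps_subst2 \<gamma> (F * G) = fps_subst2 \<gamma> F * fps_subst2 \<gamma> G"
proof -
  have "Abs_fps (\<lambda>i. (F * G) $ i oo snd \<gamma>) = Abs_fps (\<lambda>i. F $ i oo snd \<gamma>) * Abs_fps (\<lambda>i. G $ i oo snd \<gamma>)"
    using assms
    by (intro fps_ext) (simp add: fps_mult_nth[of F] fps_mult_nth[of "Abs_fps _"] centered_arc_def
        fps_compose_sum_distrib fps_compose_mult_distrib)
  with assms show ?thesis
    by (simp add: fps_subst2_def fps_subst_outer_mult centered_arc_def)
qed

lemma fps_subst2_compose:
  assumes "centered_arc \<gamma>" "t $ 0 = 0"
  shows "fps_subst2 \<gamma> F oo t = fps_subst2 (fst \<gamma> oo t, snd \<gamma> oo t) F"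
  using assms
  by (simp add: fps_subst2_def fps_subst_outer_compose centered_arc_def fps_compose_assoc)

lemma fps_subst2_const: "fps_subst2 \<gamma> (fps_const c) = c oo snd \<gamma>"
proof (rule fps_ext)
  fix n
  have "fps_subst2 \<gamma> (fps_const c) $ n = (\<Sum>i\<le>n. if i = 0 then (c oo snd \<gamma>) $ n else 0)"
    unfolding fps_subst2_def fps_subst_outer_def fps_nth_Abs_fps
    by (intro sum.cong) auto
  then show "fps_subst2 \<gamma> (fps_const c) $ n = (c oo snd \<gamma>) $ n" by simp
qed

lemma fps_subst2_X:
  assumes "centered_arc \<gamma>"
  shows "fps_subst2 \<gamma> fps_X = fst \<gamma>"
proof (rule fps_ext)
  fix n
  have "fps_subst2 \<gamma> fps_X $ n = (\<Sum>i\<le>n. if i = 1 then fst \<gamma> $ n else 0)"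
    unfolding fps_subst2_def fps_subst_outer_def fps_nth_Abs_fps
    by (intro sum.cong) auto
  then show "fps_subst2 \<gamma> fps_X $ n = fst \<gamma> $ n"
    using assms by (cases n) (auto simp: centered_arc_def)
qed

lemma
  assumes "centered_arc \<gamma>"
  shows pullback_add: "pullback \<gamma> (f + g) = pullback \<gamma> f + pullback \<gamma> g"
    and pullback_mult: "pullback \<gamma> (f * g) = pullback \<gamma> f * pullback \<gamma> g"
    and pullback_const: "pullback \<gamma> (germ_const c) = fps_const c"
    and pullback_0: "pullback \<gamma> 0 = 0"
    and pullback_1: "pullback \<gamma> 1 = 1"
    and pullback_scale: "pullback \<gamma> (germ_scale c f) = fps_const c * pullback \<gamma> f"
proof -
  have c: "fps_subst2 \<gamma> (fps_const (fps_const d)) = fps_const d" for d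
    by (simp add: fps_subst2_const)
  show add: "pullback \<gamma> (f + g) = pullback \<gamma> f + pullback \<gamma> g" for f g
    by (simp add: pullback_eq_fps_subst2[OF assms] plus_germ.rep_eq fps_subst2_add)
  show mult: "pullback \<gamma> (f * g) = pullback \<gamma> f * pullback \<gamma> g" for f g
    by (simp add: pullback_eq_fps_subst2[OF assms] times_germ.rep_eq fps_subst2_mult[OF assms])
  show const: "pullback \<gamma> (germ_const c) = fps_const c" for c
    by (simp add: pullback_eq_fps_subst2[OF assms] germ_const.rep_eq c)
  show "pullback \<gamma> 0 = 0" "pullback \<gamma> 1 = 1"
    using c[of 0] c[of 1]
    by (simp_all add: pullback_eq_fps_subst2[OF assms] zero_germ.rep_eq one_germ.rep_eq)
  show "pullback \<gamma> (germ_scale c f) = fps_const c * pullback \<gamma> f"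
    by (simp add: germ_scale_def mult const)
qed

lemma pullback_prod:
  "centered_arc \<gamma> \<Longrightarrow> pullback \<gamma> (\<Prod>i\<in>I. f i) = (\<Prod>i\<in>I. pullback \<gamma> (f i))"
  by (induction I rule: infinite_finite_induct) (simp_all add: pullback_1 pullback_mult)

lift_definition germ_x :: germ is fps_X
  unfolding conv2_iff_bound by (intro exI[of _ 1]) (auto simp: fps_X_def)

lift_definition germ_y :: germ is "fps_const fps_X"
  unfolding conv2_iff_bound by (intro exI[of _ 1]) (auto simp: fps_X_def)

lemma
  assumes "centered_arc \<gamma>"
  shows pullback_x: "pullback \<gamma> germ_x = fst \<gamma>" and pullback_y: "pullback \<gamma> germ_y = snd \<gamma>"
  using assms
  by (simp_all add: pullback_eq_fps_subst2 germ_x.rep_eq germ_y.rep_eq fps_subst2_X fps_subst2_const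
      centered_arc_def)

lemma pullback_sum:
  "centered_arc \<gamma> \<Longrightarrow> pullback \<gamma> (\<Sum>i\<in>I. f i) = (\<Sum>i\<in>I. pullback \<gamma> (f i))"
  by (induction I rule: infinite_finite_induct) (simp_all add: pullback_0 pullback_add)

lemma pullback_power: "centered_arc \<gamma> \<Longrightarrow> pullback \<gamma> (f ^ n) = pullback \<gamma> f ^ n"
  by (induction n) (simp_all add: pullback_1 pullback_mult)

lemma pullback_diff:
  assumes "centered_arc \<gamma>"
  shows "pullback \<gamma> (f - g) = pullback \<gamma> f - pullback \<gamma> g"
  using pullback_add[OF assms, of "f - g" g] by (simp add: algebra_simps)

section \<open>Weierstrass division\<close>

text \<open>
  The coefficients, with respect to the outer variable, of the quotient of \<open>g\<close> by a series \<open>Q\<close> with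
  \<open>Q $ 0 = Y^n\<close>.  Comparing coefficients in \<open>g = Q * h + r\<close> gives
  \<open>g $ m = Y^n * h $ m + (\<Sum>l=1..m. Q $ l * h $ (m - l)) + r $ m\<close>; as the degree of \<open>r $ m\<close> in \<open>Y\<close> is to be
  less than \<open>n\<close>, this determines \<open>h $ m\<close> from the earlier coefficients.  The conditional in the body only serves termination.
\<close>

fun weierstrass_quotient :: "complex fps fps \<Rightarrow> nat \<Rightarrow> complex fps fps \<Rightarrow> nat \<Rightarrow> complex fps" where
  "weierstrass_quotient Q n g m =
     fps_shift n (g $ m - (\<Sum>l=1..m. Q $ l * (if 1 \<le> l \<and> l \<le> m then weierstrass_quotient Q n g (m - l) else 0)))"

declare weierstrass_quotient.simps [simp del]

lemma weierstrass_quotient_eq: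
  "weierstrass_quotient Q n g m =
     fps_shift n (g $ m - (\<Sum>l=1..m. Q $ l * weierstrass_quotient Q n g (m - l)))"
  by (subst weierstrass_quotient.simps) (intro arg_cong[where f = "fps_shift n"] arg_cong2[where f = "(-)"] refl sum.cong, auto)

lemma weierstrass_division_formal:
  fixes Q g :: "complex fps fps"
  assumes Q: "Q $ 0 = fps_X ^ n"
  defines "h \<equiv> Abs_fps (weierstrass_quotient Q n g)"
  shows "n \<le> j \<Longrightarrow> (g - Q * h) $ m $ j = 0"
proof -
  assume j: "n \<le> j"
  define s where "s = g $ m - (\<Sum>l=1..m. Q $ l * h $ (m - l))"
  have "(Q * h) $ m = fps_X ^ n * h $ m + (\<Sum>l=1..m. Q $ l * h $ (m - l))"
    by (simp add: fps_mult_nth sum.atLeast_Suc_atMost Q)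
  moreover have "h $ m = fps_shift n s"
    by (simp add: h_def s_def weierstrass_quotient_eq[of Q n g m])
  ultimately have "(g - Q * h) $ m = s - fps_X ^ n * fps_shift n s"
    by (simp add: s_def)
  then show ?thesis using j by (simp add: fps_X_power_mult_nth)
qed

text \<open>
  If \<open>S\<close> bounds the growth of \<open>Q\<close> and \<open>g\<close> in both variables, then \<open>h\<close> grows at most like \<open>2 S\<close> in the inner
  variable and like some large \<open>T\<close> in the outer one.  The factor 2 absorbs the convolution in the
  inner variable.  In the recursion every term carries a factor \<open>S^l * T^(m - l)\<close> with \<open>l \<ge> 1\<close>, and \<open>T\<close> is chosen so that
  these terms add up to at most half of the claimed bound.
\<close>

lemma weierstrass_quotient_conv2:
  assumes "conv2 Q" "conv2 g"
  shows "conv2 (Abs_fps (weierstrass_quotient Q n g))"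
proof -
  obtain A R1 where Q: "0 \<le> A" "1 \<le> R1" "\<And>S i j. R1 \<le> S \<Longrightarrow> norm (Q $ i $ j) \<le> A * S ^ (i + j)"
    using conv2_obtain[OF assms(1)] by metis
  obtain M R2 where g: "0 \<le> M" "1 \<le> R2" "\<And>S i j. R2 \<le> S \<Longrightarrow> norm (g $ i $ j) \<le> M * S ^ (i + j)"
    using conv2_obtain[OF assms(2)] by metis
  define S where "S = max R1 R2"
  have S: "1 \<le> S" using Q(2) by (simp add: S_def)
  have QS: "norm (Q $ i $ j) \<le> A * S ^ (i + j)" and gS: "norm (g $ i $ j) \<le> M * S ^ (i + j)" for i j
    using Q(3)[of S] g(3)[of S] by (auto simp: S_def)
  \<comment> \<open>\<open>T - S = 2 * D * S\<close> is what bounds \<open>D * (\<Sum>l\<ge>1. (S / T) ^ l)\<close> by \<open>1 / 2\<close>.\<close>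
  define D where "D = 2 * A * (2 * S) ^ n"
  define T where "T = S + 2 * D * S"
  define M' where "M' = 2 * M * S ^ n"
  have D: "0 \<le> D" using Q S by (simp add: D_def)
  have T: "S \<le> T" using S D by (simp add: T_def)
  have M': "0 \<le> M'" using g S by (simp add: M'_def)
  let ?h = "weierstrass_quotient Q n g"
  have bound: "norm (?h m $ j) \<le> M' * T ^ m * (2 * S) ^ j" for m j
  proof (induction m arbitrary: j rule: less_induct)
    case (less m)
    have prod: "norm ((Q $ l * ?h (m - l)) $ (j + n)) \<le> D * M' * (2 * S) ^ j * (S ^ l * T ^ (m - l))"
      if l: "l \<in> {1..m}" for l
    proof -
      have "norm ((Q $ l * ?h (m - l)) $ (j + n))
          \<le> (\<Sum>i=0..j+n. norm (Q $ l $ i * ?h (m - l) $ (j + n - i)))"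
        unfolding fps_mult_nth by (rule norm_sum)
      also have "\<dots> \<le> (\<Sum>i=0..j+n. (A * M' * S ^ l * T ^ (m - l) * (2 * S) ^ (j + n)) * (1 / 2) ^ i)"
      proof (rule sum_mono)
        fix i assume i: "i \<in> {0..j+n}"
        have "norm (Q $ l $ i * ?h (m - l) $ (j + n - i))
            \<le> (A * S ^ (l + i)) * (M' * T ^ (m - l) * (2 * S) ^ (j + n - i))"
          unfolding norm_mult using l Q(1) S
          by (intro mult_mono QS less.IH) auto
        also have "(2 * S) ^ (j + n) = (2 * S) ^ (j + n - i) * (2 * S) ^ i"
          using i by (subst power_add[symmetric]) simp
        then have "(A * S ^ (l + i)) * (M' * T ^ (m - l) * (2 * S) ^ (j + n - i))
            = (A * M' * S ^ l * T ^ (m - l) * (2 * S) ^ (j + n)) * (1 / 2) ^ i"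
          by (simp add: power_add power_mult_distrib power_one_over)
        finally show "norm (Q $ l $ i * ?h (m - l) $ (j + n - i))
          \<le> (A * M' * S ^ l * T ^ (m - l) * (2 * S) ^ (j + n)) * (1 / 2) ^ i" .
      qed
      also have "\<dots> = (A * M' * S ^ l * T ^ (m - l) * (2 * S) ^ (j + n)) * (\<Sum>i=0..j+n. (1 / 2) ^ i)"
        by (simp add: sum_distrib_left)
      also have "\<dots> \<le> (A * M' * S ^ l * T ^ (m - l) * (2 * S) ^ (j + n)) * 2"
      proof (rule mult_left_mono)
        show "(\<Sum>i=0..j+n. (1 / 2) ^ i) \<le> (2 :: real)"
          using sum_gp_basic[of "1/2 :: real" "j + n"] by (simp add: atLeast0AtMost)
      qed (use Q M' S T in auto)
      also have "\<dots> = D * M' * (2 * S) ^ j * (S ^ l * T ^ (m - l))"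
        by (simp add: D_def power_add)
      finally show ?thesis .
    qed
    have geo: "D * (\<Sum>l=1..m. S ^ l * T ^ (m - l)) \<le> T ^ m / 2"
    proof (cases "D = 0")
      case True then show ?thesis using S T by simp
    next
      case False
      then have D0: "D > 0" using D by simp
      have "(T - S) * (\<Sum>l=1..m. S ^ l * T ^ (m - l)) = S * T ^ m - S ^ Suc m"
      proof (induction m)
        case (Suc m)
        have eq: "(\<Sum>l=1..Suc m. S ^ l * T ^ (Suc m - l)) = T * (\<Sum>l=1..m. S ^ l * T ^ (m - l)) + S ^ Suc m"
          by (simp add: sum_distrib_left Suc_diff_le mult_ac)
        have "(T - S) * (\<Sum>l=1..Suc m. S ^ l * T ^ (Suc m - l))
            = T * ((T - S) * (\<Sum>l=1..m. S ^ l * T ^ (m - l))) + (T - S) * S ^ Suc m"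
          unfolding eq by (simp add: algebra_simps)
        then show ?case unfolding Suc by (simp add: algebra_simps)
      qed simp
      also have "\<dots> \<le> S * T ^ m" using S by simp
      finally have "(T - S) * (\<Sum>l=1..m. S ^ l * T ^ (m - l)) \<le> S * T ^ m" .
      then have "2 * D * S * (\<Sum>l=1..m. S ^ l * T ^ (m - l)) \<le> S * T ^ m"
        by (simp add: T_def)
      then have "S * (2 * D * (\<Sum>l=1..m. S ^ l * T ^ (m - l))) \<le> S * T ^ m"
        by (simp add: mult_ac)
      then show ?thesis using S by simp
    qed
    have "?h m $ j = g $ m $ (j + n) - (\<Sum>l=1..m. (Q $ l * ?h (m - l)) $ (j + n))"
      by (subst weierstrass_quotient_eq) (simp add: fps_sum_nth)
    also have "norm \<dots> \<le> norm (g $ m $ (j + n)) + norm (\<Sum>l=1..m. (Q $ l * ?h (m - l)) $ (j + n))"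
      by (rule norm_triangle_ineq4)
    also have "norm (g $ m $ (j + n)) \<le> M * S ^ (m + (j + n))"
      by (rule gS)
    also have "\<dots> \<le> (M' / 2) * T ^ m * (2 * S) ^ j"
    proof -
      have "M * S ^ (m + (j + n)) = (M' / 2) * S ^ m * S ^ j" by (simp add: M'_def power_add)
      also have "\<dots> \<le> (M' / 2) * T ^ m * (2 * S) ^ j"
        using M' S T by (intro mult_mono power_mono) auto
      finally show ?thesis .
    qed
    also have "norm (\<Sum>l=1..m. (Q $ l * ?h (m - l)) $ (j + n))
        \<le> (\<Sum>l=1..m. D * M' * (2 * S) ^ j * (S ^ l * T ^ (m - l)))"
      by (rule sum_norm_le) (rule prod)
    also have "\<dots> = M' * (2 * S) ^ j * (D * (\<Sum>l=1..m. S ^ l * T ^ (m - l)))"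
      by (simp add: sum_distrib_left mult_ac)
    also have "\<dots> \<le> M' * (2 * S) ^ j * (T ^ m / 2)"
      using M' S by (intro mult_left_mono geo) auto
    finally show ?case by (simp add: mult_ac)
  qed
  show ?thesis unfolding conv2_iff_bound
  proof (intro exI conjI allI)
    show "0 < T + 2 * S" using S T by simp
    fix i j
    have "norm (?h i $ j) \<le> M' * T ^ i * (2 * S) ^ j" by (rule bound)
    also have "\<dots> \<le> M' * (T + 2 * S) ^ i * (T + 2 * S) ^ j"
      using M' S T by (intro mult_mono power_mono) auto
    finally show "norm (Abs_fps ?h $ i $ j) \<le> M' * (T + 2 * S) ^ (i + j)"
      by (simp add: power_add mult.assoc)
  qed
qed

theorem weierstrass_division:
  assumes "series Q $ 0 = fps_X ^ n"
  obtains h where "\<And>m j. n \<le> j \<Longrightarrow> series (g - Q * h) $ m $ j = 0"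
proof -
  define h where "h = Germ (Abs_fps (weierstrass_quotient (series Q) n (series g)))"
  have "series h = Abs_fps (weierstrass_quotient (series Q) n (series g))"
    unfolding h_def using series[of Q] series[of g]
    by (intro Germ_inverse) (simp add: weierstrass_quotient_conv2)
  then have "series (g - Q * h) $ m $ j = 0" if "n \<le> j" for m j
    using weierstrass_division_formal[OF assms that, of "series g" m]
    by (simp add: minus_germ.rep_eq times_germ.rep_eq)
  then show thesis by (rule that)
qed

section \<open>Primitive arcs and normalizing parameters\<close>

lemma has_fps_expansion_unique:
  fixes f :: "complex \<Rightarrow> complex"
  assumes "f has_fps_expansion F" "g has_fps_expansion G" "eventually (\<lambda>z. f z = g z) (nhds 0)"
  shows "F = G"
proof -
  have "f has_fps_expansion G"
    using has_fps_expansion_cong[OF assms(3) refl, of G] assms(2) by simp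
  then show ?thesis
    by (simp add: fps_eq_iff fps_nth_fps_expansion[OF assms(1)] fps_nth_fps_expansion[of f G])
qed

lemma has_fps_expansion_pow:
  fixes f :: "complex \<Rightarrow> complex"
  shows "f has_fps_expansion F \<Longrightarrow> (\<lambda>z. f z ^ n) has_fps_expansion F ^ n"
  by (induction n) (auto intro: has_fps_expansion_mult)

text \<open>
  A holomorphic function with a zero of order \<open>n\<close> is the \<open>n\<close>th power of a local coordinate; \<open>t\<close> is the
  inverse of that coordinate.
\<close>

lemma fps_normalizing_parameter:
  fixes u :: "complex fps"
  assumes conv: "fps_conv_radius u > 0" and u: "u \<noteq> 0" "u $ 0 = 0"
  obtains t where "fps_conv_radius t > 0" "t $ 0 = 0" "t $ 1 \<noteq> 0" "u oo t = fps_X ^ subdegree u"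
proof -
  define n where "n = subdegree u"
  have n: "n > 0" unfolding n_def using u by (metis gr0I nth_subdegree_nonzero)
  have U: "eval_fps u has_fps_expansion u"
    using conv by (rule eval_fps_has_fps_expansion)
  have nth: "(deriv ^^ i) (eval_fps u) 0 = fact i * u $ i" for i
    using fps_nth_fps_expansion[OF U, of i] by simp
  let ?S = "eball 0 (fps_conv_radius u) :: complex set"
  have S: "0 \<in> ?S" using conv by (simp add: zero_ereal_def)
  obtain g r where r: "0 < r" and g: "g holomorphic_on ball 0 r"
    and eq: "\<And>z. z \<in> ball 0 r \<Longrightarrow> eval_fps u z - eval_fps u 0 = ((z - 0) * g z) ^ n"
    and g0: "\<And>z. z \<in> ball 0 r \<Longrightarrow> g z \<noteq> 0"
  proof (rule holomorphic_factor_order_of_zero_strong[of "eval_fps u" ?S 0 n])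
    show "eval_fps u holomorphic_on ?S" by (rule holomorphic_on_eval_fps) simp
    show "(deriv ^^ n) (eval_fps u) 0 \<noteq> 0" using u(1) by (simp add: nth n_def)
    show "(deriv ^^ i) (eval_fps u) 0 = 0" if "0 < i" "i < n" for i
      using that nth_less_subdegree_zero[of i u] by (simp add: nth n_def)
  qed (use S n in auto)
  define w where "w = (\<lambda>z. z * g z)"
  have w: "w holomorphic_on ball 0 r"
    unfolding w_def using g by (intro holomorphic_intros)
  have "(g has_field_derivative deriv g 0) (at 0)"
    using g r by (intro holomorphic_derivI[of g "ball 0 r"]) auto
  then have "(w has_field_derivative g 0) (at 0)"
    unfolding w_def by (auto intro!: derivative_eq_intros)
  then have dw: "deriv w 0 = g 0" by (rule DERIV_imp_deriv)
  obtain s where s: "s > 0" "ball 0 s \<subseteq> (ball 0 r :: complex set)" "open (w ` ball 0 s)" "inj_on w (ball 0 s)"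
  proof (rule has_complex_derivative_locally_invertible[OF w])
    show "0 \<in> ball (0 :: complex) r" "deriv w 0 \<noteq> 0" using r dw g0[of 0] by simp_all
  qed (rule open_ball, rule that)
  obtain T where T: "T holomorphic_on (w ` ball 0 s)"
    and dT: "\<And>z. z \<in> ball 0 s \<Longrightarrow> deriv w z * deriv T (w z) = 1"
    and Tw: "\<And>z. z \<in> ball 0 s \<Longrightarrow> T (w z) = z"
    using holomorphic_has_inverse[OF holomorphic_on_subset[OF w s(2)] open_ball s(4)] by metis
  have w0: "w 0 = 0" by (simp add: w_def)
  have mem: "0 \<in> w ` ball 0 s" using s(1) w0 by (metis centre_in_ball imageI)
  define t where "t = fps_expansion T 0"
  have t: "T has_fps_expansion t"
    unfolding t_def using s(3) mem T by (rule has_fps_expansion_fps_expansion)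
  have t0: "t $ 0 = 0"
    using fps_nth_fps_expansion[OF t, of 0] Tw[of 0] s(1) w0 by simp
  have t1: "t $ 1 \<noteq> 0"
    using fps_nth_fps_expansion[OF t, of 1] dT[of 0] s(1) w0 by auto
  have "(eval_fps u \<circ> T) has_fps_expansion (u oo t)"
    by (rule has_fps_expansion_compose[OF U t t0])
  moreover have "(\<lambda>z. z ^ n) has_fps_expansion fps_X ^ n"
    by (rule has_fps_expansion_fps_X_power)
  moreover have "eventually (\<lambda>z. (eval_fps u \<circ> T) z = z ^ n) (nhds 0)"
  proof -
    have "eventually (\<lambda>z. z \<in> w ` ball 0 s) (nhds 0)"
      using s(3) mem by (rule eventually_nhds_in_open)
    then show ?thesis
    proof eventually_elim
      case (elim z)
      then obtain y where y: "y \<in> ball 0 s" "z = w y" by blast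
      then have "eval_fps u y = w y ^ n"
        using eq[of y] s(2) u(2) by (auto simp: w_def eval_fps_at_0)
      then show ?case using y Tw by simp
    qed
  qed
  ultimately have "u oo t = fps_X ^ n" by (rule has_fps_expansion_unique)
  with t t0 t1 show thesis unfolding n_def by (intro that) (auto simp: has_fps_expansion_def)
qed


definition convergent_arc :: "arc \<Rightarrow> bool" where
  "convergent_arc \<gamma> \<longleftrightarrow> fps_conv_radius (fst \<gamma>) > 0 \<and> fps_conv_radius (snd \<gamma>) > 0"

text \<open>
  The part of the definition of a uniformization that concerns the arc alone: a parametrization
  that passes through each of its points only once.
\<close>

definition primitive_arc :: "arc \<Rightarrow> bool" where
  "primitive_arc \<gamma> \<longleftrightarrow> convergent_arc \<gamma> \<and> centered_arc \<gamma> \<and>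
     (\<exists>U. open U \<and> 0 \<in> U \<and> inj_on (arc_eval \<gamma>) U)"

lemma uniformization_imp_primitive_arc:
  assumes "uniformization g \<gamma>"
  shows "primitive_arc \<gamma>"
proof -
  obtain U V \<delta> where U: "open U" "0 \<in> U"
    and h: "homeomorphism U {p \<in> V. germ_eval g p = 0} (arc_eval \<gamma>) \<delta>"
    using assms unfolding uniformization_def by blast
  have "inj_on (arc_eval \<gamma>) U"
    using homeomorphism_apply1[OF h] by (metis inj_onI)
  with U assms show ?thesis
    unfolding primitive_arc_def convergent_arc_def centered_arc_def uniformization_def by blast
qed

text \<open>
  An injective arc is a monomorphism for substitutions, already on the level of Taylor series.
\<close>

lemma primitive_arc_cancel:
  assumes \<gamma>: "primitive_arc \<gamma>"
    and s: "fps_conv_radius s > 0" "s $ 0 = 0" and t: "fps_conv_radius t > 0" "t $ 0 = 0"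
    and eq: "fst \<gamma> oo s = fst \<gamma> oo t" "snd \<gamma> oo s = snd \<gamma> oo t"
  shows "s = t"
proof -
  obtain U where U: "open U" "0 \<in> U" and inj: "inj_on (arc_eval \<gamma>) U"
    using \<gamma> unfolding primitive_arc_def by blast
  have ev: "eventually (\<lambda>z. eval_fps p (eval_fps s z) = eval_fps p (eval_fps t z)) (nhds 0)"
    if p: "fps_conv_radius p > 0" "p oo s = p oo t" for p
  proof -
    have "(eval_fps p \<circ> eval_fps s) has_fps_expansion (p oo s)"
      "(eval_fps p \<circ> eval_fps t) has_fps_expansion (p oo t)"
      by (rule has_fps_expansion_compose[OF eval_fps_has_fps_expansion[OF p(1)]
            eval_fps_has_fps_expansion[OF s(1)] s(2)],
          rule has_fps_expansion_compose[OF eval_fps_has_fps_expansion[OF p(1)]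
            eval_fps_has_fps_expansion[OF t(1)] t(2)])
    then have "eventually (\<lambda>z. eval_fps (p oo s) z = (eval_fps p \<circ> eval_fps s) z) (nhds 0)"
      "eventually (\<lambda>z. eval_fps (p oo t) z = (eval_fps p \<circ> eval_fps t) z) (nhds 0)"
      unfolding has_fps_expansion_def by auto
    then show ?thesis by eventually_elim (simp add: p(2))
  qed
  have near: "eventually (\<lambda>z. eval_fps p z \<in> U) (nhds 0)"
    if p: "fps_conv_radius p > 0" "p $ 0 = 0" for p :: "complex fps"
  proof -
    have "isCont (eval_fps p) 0"
      using has_fps_expansion_imp_continuous[OF eval_fps_has_fps_expansion[OF p(1)]] .
    then have "(eval_fps p \<longlongrightarrow> 0) (at 0)"
      using p(2) by (simp add: isCont_def eval_fps_at_0)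
    then have "eventually (\<lambda>z. eval_fps p z \<in> U) (at 0)"
      using U by (rule topological_tendstoD)
    then show ?thesis
      using U(2) p(2) by (simp add: eventually_nhds_conv_at eval_fps_at_0)
  qed
  have conv: "fps_conv_radius (fst \<gamma>) > 0" "fps_conv_radius (snd \<gamma>) > 0"
    using \<gamma> unfolding primitive_arc_def convergent_arc_def by auto
  have "eventually (\<lambda>z. eval_fps s z = eval_fps t z) (nhds 0)"
    using ev[OF conv(1) eq(1)] ev[OF conv(2) eq(2)] near[OF s] near[OF t]
  proof eventually_elim
    case (elim z)
    then have "arc_eval \<gamma> (eval_fps s z) = arc_eval \<gamma> (eval_fps t z)"
      by (simp add: arc_eval_def)
    from inj_onD[OF inj this] elim show ?case by blast
  qed
  then show ?thesis
    by (rule has_fps_expansion_unique[OF eval_fps_has_fps_expansion[OF s(1)]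
          eval_fps_has_fps_expansion[OF t(1)]])
qed

lemma primitive_root_of_unity_exists:
  assumes "n > 0"
  obtains z :: complex where "\<And>k. z ^ k = 1 \<longleftrightarrow> n dvd k"
proof -
  define z where "z = exp (2 * of_real pi * \<i> * of_nat 1 / of_nat n)"
  have "z ^ k = exp (2 * of_real pi * \<i> * of_nat k / of_nat n)" for k
    unfolding z_def exp_of_nat_mult[symmetric] by (simp add: mult_ac)
  moreover have "exp (2 * of_real pi * \<i> * of_nat k / of_nat n) = 1 \<longleftrightarrow> n dvd k" for k
    using complex_root_unity_eq[of n k 0] assms by (simp add: dvd_eq_mod_eq_0)
  ultimately show thesis by (intro that[of z]) simp
qed

abbreviation fps_rotate :: "complex \<Rightarrow> complex fps \<Rightarrow> complex fps" where
  "fps_rotate c p \<equiv> p oo (fps_const c * fps_X)"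

lemma fps_conv_radius_rotate:
  assumes "fps_conv_radius p > 0"
  shows "fps_conv_radius (fps_rotate c p) > 0"
proof -
  have "fps_conv_radius (fps_const c * fps_X) > 0"
    by (rule less_le_trans[OF _ fps_conv_radius_mult]) simp
  with has_fps_expansion_compose[OF eval_fps_has_fps_expansion[OF assms]
      eval_fps_has_fps_expansion, of "fps_const c * fps_X"]
  show ?thesis by (simp add: has_fps_expansion_def)
qed

text \<open>
  No two different rescalings of the parameter give the same arc.  This is the only form in which
  injectivity of a branch enters the algebraic arguments below.
\<close>

lemma primitive_arc_rotate_inj:
  assumes \<gamma>: "primitive_arc \<gamma>" and t: "fps_conv_radius t > 0" "t $ 0 = 0" "t $ 1 \<noteq> 0"
    and eq: "fps_rotate a (fst \<gamma> oo t) = fps_rotate b (fst \<gamma> oo t)"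
      "fps_rotate a (snd \<gamma> oo t) = fps_rotate b (snd \<gamma> oo t)"
  shows "a = b"
proof -
  have "fps_rotate a t = fps_rotate b t"
    using \<gamma>
  proof (rule primitive_arc_cancel)
    show "fst \<gamma> oo fps_rotate a t = fst \<gamma> oo fps_rotate b t"
      using eq(1) t by (simp add: fps_compose_assoc)
    show "snd \<gamma> oo fps_rotate a t = snd \<gamma> oo fps_rotate b t"
      using eq(2) t by (simp add: fps_compose_assoc)
  qed (use t in \<open>simp_all add: fps_conv_radius_rotate\<close>)
  then have "fps_rotate a t $ 1 = fps_rotate b t $ 1" by simp
  then show "a = b" using t by (simp add: fps_compose_linear)
qed

section \<open>A germ vanishes along its uniformization\<close>

text \<open>
  The terms outside the square \<open>i, j \<le> m\<close> have total degree greater than \<open>m\<close>, so shrinking the point from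
  distance \<open>\<rho>\<close> to distance \<open>d\<close> multiplies them by at most \<open>(d / \<rho>) ^ Suc m\<close>.
\<close>

lemma germ_eval_truncation_bound:
  obtains C \<rho> where "0 < \<rho>" "0 \<le> C"
    "\<And>d x y. 0 \<le> d \<Longrightarrow> d \<le> \<rho> \<Longrightarrow> norm x \<le> d \<Longrightarrow> norm y \<le> d \<Longrightarrow>
       norm (germ_eval f (x, y) - (\<Sum>i\<le>m. \<Sum>j\<le>m. series f $ i $ j * x ^ i * y ^ j)) \<le> C * d ^ Suc m"
proof -
  obtain \<rho> where \<rho>: "\<rho> > 0"
    and sum: "(\<lambda>(i, j). norm (series f $ i $ j) * \<rho> ^ (i + j)) summable_on (UNIV :: (nat \<times> nat) set)"
    using series[of f] unfolding conv2_def by auto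
  define G where "G = (\<lambda>(i, j). norm (series f $ i $ j) * \<rho> ^ (i + j))"
  define B where "B = {..m} \<times> {..m}"
  have G: "G summable_on A" for A
    using sum by (auto simp: G_def intro: summable_on_subset_banach)
  show thesis
  proof (rule that)
    show "0 \<le> infsum G (- B) / \<rho> ^ Suc m"
      using \<rho> by (intro divide_nonneg_nonneg infsum_nonneg) (auto simp: G_def)
    fix d :: real and x y :: complex
    assume d: "0 \<le> d" "d \<le> \<rho>" and xy: "norm x \<le> d" "norm y \<le> d"
    define T where "T = (\<lambda>(i, j). series f $ i $ j * x ^ i * y ^ j)"
    have le: "norm (T p) \<le> norm (series f $ fst p $ snd p) * d ^ (fst p + snd p)" for p
    proof -
      have "norm x ^ fst p * norm y ^ snd p \<le> d ^ fst p * d ^ snd p"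
        using xy d by (intro mult_mono power_mono) auto
      from mult_left_mono[OF this, of "norm (series f $ fst p $ snd p)"] show ?thesis
        by (simp add: T_def case_prod_beta norm_mult norm_power power_add mult.assoc)
    qed
    have leG: "norm (T p) \<le> G p" for p
    proof (rule order_trans[OF le])
      have "d ^ (fst p + snd p) \<le> \<rho> ^ (fst p + snd p)" using d by (intro power_mono)
      from mult_left_mono[OF this, of "norm (series f $ fst p $ snd p)"]
      show "norm (series f $ fst p $ snd p) * d ^ (fst p + snd p) \<le> G p"
        by (simp add: G_def case_prod_beta)
    qed
    have abs: "(\<lambda>p. norm (T p)) summable_on A" for A
      by (rule Infinite_Sum.abs_summable_on_comparison_test'[OF G leG])
    have summ: "T summable_on A" for A
      using abs by (rule abs_summable_summable)
    have "germ_eval f (x, y) = infsum T (B \<union> - B)"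
      by (simp add: germ_eval_def T_def)
    also have "\<dots> = infsum T B + infsum T (- B)"
      by (rule infsum_Un_disjoint) (simp_all add: summ)
    also have "infsum T B = (\<Sum>i\<le>m. \<Sum>j\<le>m. series f $ i $ j * x ^ i * y ^ j)"
      by (simp add: B_def T_def sum.cartesian_product)
    finally have "norm (germ_eval f (x, y) - (\<Sum>i\<le>m. \<Sum>j\<le>m. series f $ i $ j * x ^ i * y ^ j))
        = norm (infsum T (- B))" by simp
    also have "\<dots> \<le> infsum (\<lambda>p. norm (T p)) (- B)"
      using abs by (rule norm_infsum_bound)
    also have "\<dots> \<le> infsum (\<lambda>p. (d / \<rho>) ^ Suc m * G p) (- B)"
    proof (rule infsum_mono)
      fix p assume p: "p \<in> - B"
      then have big: "Suc m \<le> fst p + snd p" by (cases p) (auto simp: B_def)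
      have "(d / \<rho>) ^ (fst p + snd p) \<le> (d / \<rho>) ^ Suc m"
        using d \<rho> big by (intro power_decreasing) auto
      then have "d ^ (fst p + snd p) \<le> (d / \<rho>) ^ Suc m * \<rho> ^ (fst p + snd p)"
        using \<rho> by (simp add: power_divide divide_simps mult.commute del: power_Suc)
      from mult_left_mono[OF this, of "norm (series f $ fst p $ snd p)"] le[of p]
      show "norm (T p) \<le> (d / \<rho>) ^ Suc m * G p"
        by (simp add: G_def case_prod_beta mult_ac del: power_Suc)
    qed (use abs G in \<open>auto intro: summable_on_cmult_right simp del: power_Suc\<close>)
    also have "\<dots> = (d / \<rho>) ^ Suc m * infsum G (- B)"
      by (rule infsum_cmult_right')
    also have "\<dots> = infsum G (- B) / \<rho> ^ Suc m * d ^ Suc m"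
      by (simp add: power_divide del: power_Suc)
    finally show "norm (germ_eval f (x, y) - (\<Sum>i\<le>m. \<Sum>j\<le>m. series f $ i $ j * x ^ i * y ^ j))
      \<le> infsum G (- B) / \<rho> ^ Suc m * d ^ Suc m" .
  qed (fact \<rho>)
qed

lemma truncated_pullback_nth:
  assumes "centered_arc \<gamma>" "k \<le> m"
  shows "(\<Sum>i\<le>m. \<Sum>j\<le>m. fps_const (series f $ i $ j) * fst \<gamma> ^ i * snd \<gamma> ^ j) $ k = pullback \<gamma> f $ k"
proof -
  have xy: "fst \<gamma> $ 0 = 0" "snd \<gamma> $ 0 = 0" using assms(1) by (auto simp: centered_arc_def)
  have zero: "(fst \<gamma> ^ i * snd \<gamma> ^ j) $ k = 0" if "k < i + j" for i j
    using fps_mult_low_nth_zero[of i "fst \<gamma> ^ i" j "snd \<gamma> ^ j" k] that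
      fps_power_low_nth_zero[OF xy(1), of _ i] fps_power_low_nth_zero[OF xy(2), of _ j] by blast
  have "(\<Sum>j\<le>k. series f $ i $ j * (fst \<gamma> ^ i * snd \<gamma> ^ j) $ k)
      = (\<Sum>j\<le>m. series f $ i $ j * (fst \<gamma> ^ i * snd \<gamma> ^ j) $ k)" for i
    using assms(2) zero by (intro sum.mono_neutral_left) (simp_all add: not_le)
  then have "pullback \<gamma> f $ k = (\<Sum>i\<le>k. \<Sum>j\<le>m. series f $ i $ j * (fst \<gamma> ^ i * snd \<gamma> ^ j) $ k)"
    by (simp add: pullback_def)
  also have "\<dots> = (\<Sum>i\<le>m. \<Sum>j\<le>m. series f $ i $ j * (fst \<gamma> ^ i * snd \<gamma> ^ j) $ k)"
    using assms(2) zero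
    by (intro sum.mono_neutral_left) (simp_all add: not_le)
  finally show ?thesis by (simp add: fps_sum_nth mult.assoc)
qed

lemma fps_eval_linear_bound:
  fixes x :: "complex fps"
  assumes "fps_conv_radius x > 0" "x $ 0 = 0"
  obtains K where "K > 0" "eventually (\<lambda>z. norm (eval_fps x z) \<le> K * norm z) (nhds 0)"
proof -
  have exp: "eval_fps x has_fps_expansion x"
    using assms(1) by (rule eval_fps_has_fps_expansion)
  define K where "K = norm (x $ 1) + 1"
  have "(eval_fps x has_field_derivative deriv (eval_fps x) 0) (at 0)"
    using exp by (intro holomorphic_derivI[of _ "eball 0 (fps_conv_radius x)"] holomorphic_on_eval_fps)
      (use assms(1) in \<open>auto simp: zero_ereal_def\<close>)
  moreover have "deriv (eval_fps x) 0 = x $ 1"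
    using fps_nth_fps_expansion[OF exp, of 1] by simp
  ultimately have "((\<lambda>z. eval_fps x z / z) \<longlongrightarrow> x $ 1) (at 0)"
    using assms(2) by (simp add: has_field_derivative_iff eval_fps_at_0)
  then have "((\<lambda>z. norm (eval_fps x z / z)) \<longlongrightarrow> norm (x $ 1)) (at 0)"
    by (rule tendsto_norm)
  then have "eventually (\<lambda>z. norm (eval_fps x z / z) < K) (at 0)"
    by (rule order_tendstoD) (simp add: K_def)
  then have "eventually (\<lambda>z. z \<noteq> 0 \<longrightarrow> norm (eval_fps x z) \<le> K * norm z) (nhds 0)"
    unfolding eventually_at_filter
    by eventually_elim (auto simp: norm_divide divide_simps)
  then have "eventually (\<lambda>z. norm (eval_fps x z) \<le> K * norm z) (nhds 0)"
    by eventually_elim (use assms(2) in \<open>auto simp: eval_fps_at_0\<close>)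
  then show thesis by (intro that[of K]) (auto simp: K_def add_nonneg_pos)
qed

text \<open>
  The pullback is a formal object, whereas a uniformization lies in the zero set in the analytic sense.  They are compared
  through a truncation: if the pullback had order \<open>m\<close>, then the truncation of \<open>g\<close> at degree \<open>m\<close> along
  the arc would behave like \<open>t^m\<close>, but it differs from \<open>g(\<gamma>(t)) = 0\<close> by \<open>O(t^(m + 1))\<close> only.
\<close>

theorem uniformization_pullback_eq_0:
  assumes unif: "uniformization g \<gamma>"
  shows "pullback \<gamma> g = 0"
proof (rule ccontr)
  assume nz: "pullback \<gamma> g \<noteq> 0"
  define m where "m = subdegree (pullback \<gamma> g)"
  have prim: "convergent_arc \<gamma>" "centered_arc \<gamma>"
    using uniformization_imp_primitive_arc[OF unif] unfolding primitive_arc_def by auto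
  define x y where "x = fst \<gamma>" and "y = snd \<gamma>"
  have x: "fps_conv_radius x > 0" "x $ 0 = 0" and y: "fps_conv_radius y > 0" "y $ 0 = 0"
    using prim by (auto simp: x_def y_def convergent_arc_def centered_arc_def)
  define P where "P = (\<Sum>i\<le>m. \<Sum>j\<le>m. fps_const (series g $ i $ j) * x ^ i * y ^ j)"
  define p where "p = (\<lambda>t. \<Sum>i\<le>m. \<Sum>j\<le>m. series g $ i $ j * eval_fps x t ^ i * eval_fps y t ^ j)"
  have pP: "p has_fps_expansion P"
    unfolding p_def P_def using x y
    by (intro has_fps_expansion_sum has_fps_expansion_mult has_fps_expansion_pow
        has_fps_expansion_const eval_fps_has_fps_expansion)
  have P_nth: "P $ k = pullback \<gamma> g $ k" if "k \<le> m" for k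
    using truncated_pullback_nth[OF prim(2) that, of g] by (simp add: P_def x_def y_def)
  have Pm: "P $ m \<noteq> 0" using P_nth[of m] nz by (simp add: m_def)
  have Psub: "subdegree P = m"
  proof (rule subdegreeI[OF Pm])
    fix i assume i: "i < m"
    then have "pullback \<gamma> g $ i = 0" unfolding m_def by (rule nth_less_subdegree_zero)
    with P_nth[of i] i show "P $ i = 0" by simp
  qed
  have shift: "(\<lambda>t. if t = 0 then P $ m else p t / t ^ m) has_fps_expansion fps_shift m P"
    using pP Psub by (intro has_fps_expansion_shift) auto
  obtain U V \<delta> where U: "open U" "0 \<in> U"
    and h: "homeomorphism U {p \<in> V. germ_eval g p = 0} (arc_eval \<gamma>) \<delta>"
    using unif unfolding uniformization_def by blast
  have zero: "germ_eval g (eval_fps x t, eval_fps y t) = 0" if "t \<in> U" for t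
    using homeomorphism_image1[OF h] that by (auto simp: arc_eval_def x_def y_def)
  obtain C \<rho> where \<rho>: "0 < \<rho>" "0 \<le> C" and bound:
    "\<And>d a b. 0 \<le> d \<Longrightarrow> d \<le> \<rho> \<Longrightarrow> norm a \<le> d \<Longrightarrow> norm b \<le> d \<Longrightarrow>
       norm (germ_eval g (a, b) - (\<Sum>i\<le>m. \<Sum>j\<le>m. series g $ i $ j * a ^ i * b ^ j)) \<le> C * d ^ Suc m"
    by (rule germ_eval_truncation_bound[of g m]) (rule that)
  obtain K1 where K1: "K1 > 0" "eventually (\<lambda>t. norm (eval_fps x t) \<le> K1 * norm t) (nhds 0)"
    by (rule fps_eval_linear_bound[OF x])
  obtain K2 where K2: "K2 > 0" "eventually (\<lambda>t. norm (eval_fps y t) \<le> K2 * norm t) (nhds 0)"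
    by (rule fps_eval_linear_bound[OF y])
  define K where "K = max K1 K2"
  have K: "K > 0" "K1 \<le> K" "K2 \<le> K" using K1(1) by (auto simp: K_def)
  have inU: "eventually (\<lambda>t. t \<in> U) (nhds 0)" using U by (rule eventually_nhds_in_open)
  have small: "eventually (\<lambda>t :: complex. t \<in> ball 0 (\<rho> / K)) (nhds 0)"
    using \<rho> K by (intro eventually_nhds_in_open) auto
  have "eventually (\<lambda>t. norm (p t) \<le> C * (K * norm t) ^ Suc m) (nhds 0)"
    using inU K1(2) K2(2) small
  proof eventually_elim
    case (elim t)
    have "norm (germ_eval g (eval_fps x t, eval_fps y t) - p t) \<le> C * (K * norm t) ^ Suc m"
      unfolding p_def
    proof (rule bound)
      show "K * norm t \<le> \<rho>" using elim(4) K by (simp add: field_simps)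
      show "norm (eval_fps x t) \<le> K * norm t"
        using elim(2) mult_right_mono[OF K(2) norm_ge_zero[of t]] by linarith
      show "norm (eval_fps y t) \<le> K * norm t"
        using elim(3) mult_right_mono[OF K(3) norm_ge_zero[of t]] by linarith
    qed (use K in auto)
    then show ?case using zero[OF elim(1)] by simp
  qed
  then have ev: "eventually (\<lambda>t. norm (p t / t ^ m) \<le> C * K ^ Suc m * norm t) (at 0)"
    unfolding eventually_at_filter
    by eventually_elim (auto simp: norm_divide norm_power divide_simps power_mult_distrib mult_ac)
  have "((\<lambda>t :: complex. C * K ^ Suc m * norm t) \<longlongrightarrow> C * K ^ Suc m * norm (0 :: complex)) (at 0)"
    by (intro tendsto_intros)
  then have "((\<lambda>t. p t / t ^ m) \<longlongrightarrow> 0) (at 0)"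
    by (intro Lim_null_comparison[OF ev]) simp
  moreover have "((\<lambda>t. p t / t ^ m) \<longlongrightarrow> P $ m) (at 0)"
  proof -
    have "((\<lambda>t. if t = 0 then P $ m else p t / t ^ m) \<longlongrightarrow> P $ m) (at 0)"
      using has_fps_expansion_imp_continuous[OF shift, of UNIV] unfolding isCont_def by simp
    then show ?thesis
      by (rule Lim_transform_eventually) (simp add: eventually_at_filter)
  qed
  ultimately have "P $ m = 0" using tendsto_unique[of "at (0::complex)"] by (metis at_neq_bot)
  with Pm show False by contradiction
qed

section \<open>The value semigroup of a branch\<close>

text \<open>
  The differences of elements of \<open>S\<close> form a subgroup of the integers; \<open>d\<close> is its positive generator.
\<close>

lemma additive_monoid_minimal_gap:
  fixes S :: "nat set"
  assumes 0: "0 \<in> S" and add: "\<And>a b. a \<in> S \<Longrightarrow> b \<in> S \<Longrightarrow> a + b \<in> S" and pos: "\<exists>s\<in>S. s > 0"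
  obtains a d where "d > 0" "a \<in> S" "a + d \<in> S" "\<And>s. s \<in> S \<Longrightarrow> d dvd s"
proof -
  define gap where "gap = (\<lambda>d. d > 0 \<and> (\<exists>a. a \<in> S \<and> a + d \<in> S))"
  have ex: "gap d" if "d \<in> S" "d > 0" for d
    using that 0 unfolding gap_def by auto
  define d where "d = (LEAST d. gap d)"
  have d: "gap d" unfolding d_def using pos ex by (metis LeastI)
  then obtain a where a: "d > 0" "a \<in> S" "a + d \<in> S" unfolding gap_def by blast
  have mult: "k * s \<in> S" if "s \<in> S" for k s
    using that 0 by (induction k) (auto intro: add)
  have "d dvd s" if s: "s \<in> S" for s
  proof (rule ccontr)
    assume "\<not> d dvd s"
    then have "s mod d > 0" by (simp add: dvd_eq_mod_eq_0)
    moreover have "(s div d) * (a + d) + s mod d = s + (s div d) * a"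
      by (metis add.commute add.left_commute add_mult_distrib2 div_mult_mod_eq)
    then have "(s div d) * (a + d) + s mod d \<in> S"
      using add[OF s mult[OF a(2), of "s div d"]] by simp
    ultimately have "gap (s mod d)"
      unfolding gap_def using mult[OF a(3), of "s div d"] by blast
    then have "d \<le> s mod d" unfolding d_def by (rule Least_le)
    then show False using mod_less_divisor[OF a(1), of s] by linarith
  qed
  with a that show thesis by blast
qed

text \<open>
  Divide \<open>n\<close> by \<open>a\<close> and replace as many summands \<open>a\<close> by \<open>a + 1\<close> as the remainder requires.
\<close>

lemma additive_monoid_consecutive:
  fixes S :: "nat set"
  assumes 0: "0 \<in> S" and add: "\<And>a b. a \<in> S \<Longrightarrow> b \<in> S \<Longrightarrow> a + b \<in> S"
    and a: "a \<in> S" "Suc a \<in> S" and n: "a * a \<le> n"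
  shows "n \<in> S"
proof -
  have mult: "k * s \<in> S" if "s \<in> S" for k s
    using that 0 by (induction k) (auto intro: add)
  show ?thesis
  proof (cases "a = 0")
    case True
    then show ?thesis using mult[OF a(2), of n] by simp
  next
    case False
    define q r where "q = n div a" and "r = n mod a"
    have "r < a" using False by (simp add: r_def)
    moreover have "a \<le> q" unfolding q_def using n False by (simp add: less_eq_div_iff_mult_less_eq)
    ultimately have "(q - r) * a + r * Suc a = q * a + r"
      by (simp add: algebra_simps flip: add_mult_distrib)
    also have "\<dots> = n" by (simp add: q_def r_def)
    finally show ?thesis using add[OF mult[OF a(1)] mult[OF a(2)]] by metis
  qed
qed

text \<open>
  Truncation replaces a germ by a polynomial, whose pullback visibly converges.
\<close>

lemma convergent_pullback_same_order:
  assumes \<gamma>: "convergent_arc \<gamma>" "centered_arc \<gamma>" and f: "pullback \<gamma> f \<noteq> 0"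
  obtains p where "fps_conv_radius (pullback \<gamma> p) > 0" "pullback \<gamma> p \<noteq> 0"
    "subdegree (pullback \<gamma> p) = subdegree (pullback \<gamma> f)"
proof -
  define m where "m = subdegree (pullback \<gamma> f)"
  define p where "p = (\<Sum>i\<le>m. \<Sum>j\<le>m. germ_const (series f $ i $ j) * germ_x ^ i * germ_y ^ j)"
  have P: "pullback \<gamma> p
      = (\<Sum>i\<le>m. \<Sum>j\<le>m. fps_const (series f $ i $ j) * fst \<gamma> ^ i * snd \<gamma> ^ j)"
    using \<gamma>(2) by (simp add: p_def pullback_sum pullback_mult pullback_power pullback_const pullback_x pullback_y)
  have nth: "pullback \<gamma> p $ k = pullback \<gamma> f $ k" if "k \<le> m" for k
    using truncated_pullback_nth[OF \<gamma>(2) that] P by simp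
  have nz: "pullback \<gamma> p $ m \<noteq> 0" using nth[of m] f by (simp add: m_def)
  have "subdegree (pullback \<gamma> p) = m"
  proof (rule subdegreeI[OF nz])
    fix i assume i: "i < m"
    then have "pullback \<gamma> f $ i = 0" unfolding m_def by (rule nth_less_subdegree_zero)
    with nth[of i] i show "pullback \<gamma> p $ i = 0" by simp
  qed
  moreover have "(\<lambda>t. \<Sum>i\<le>m. \<Sum>j\<le>m. series f $ i $ j * eval_fps (fst \<gamma>) t ^ i * eval_fps (snd \<gamma>) t ^ j)
      has_fps_expansion pullback \<gamma> p"
    unfolding P using \<gamma>(1)
    by (intro has_fps_expansion_sum has_fps_expansion_mult has_fps_expansion_pow
        has_fps_expansion_const eval_fps_has_fps_expansion) (auto simp: convergent_arc_def)
  ultimately show thesis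
    using nz by (intro that[of p]) (auto simp: has_fps_expansion_def m_def)
qed

text \<open>
  The value semigroup of the branch.
\<close>

definition arc_orders :: "arc \<Rightarrow> nat set" where
  "arc_orders \<gamma> = {subdegree (pullback \<gamma> f) | f. pullback \<gamma> f \<noteq> 0}"

lemma arc_orders_0: "centered_arc \<gamma> \<Longrightarrow> 0 \<in> arc_orders \<gamma>"
  unfolding arc_orders_def using pullback_1[of \<gamma>] by (auto intro!: exI[of _ 1])

lemma arc_orders_add:
  assumes "centered_arc \<gamma>" "a \<in> arc_orders \<gamma>" "b \<in> arc_orders \<gamma>"
  shows "a + b \<in> arc_orders \<gamma>"
proof -
  obtain f g where "pullback \<gamma> f \<noteq> 0" "subdegree (pullback \<gamma> f) = a"
    "pullback \<gamma> g \<noteq> 0" "subdegree (pullback \<gamma> g) = b"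
    using assms unfolding arc_orders_def by blast
  then show ?thesis
    unfolding arc_orders_def using pullback_mult[OF assms(1), of f g] by (auto intro!: exI[of _ "f * g"])
qed

lemma primitive_arc_nonzero:
  assumes "primitive_arc \<gamma>"
  shows "fst \<gamma> \<noteq> 0 \<or> snd \<gamma> \<noteq> 0"
proof (rule ccontr)
  assume "\<not> ?thesis"
  then show False
    using primitive_arc_rotate_inj[OF assms, of fps_X 0 1] by simp
qed

text \<open>
  If the quotient of two pullbacks becomes \<open>s^d\<close> in the parameter \<open>s\<close> given by \<open>t\<close>, and all orders are
  multiples of \<open>d\<close>, then every pullback is a series in \<open>s^d\<close>.  Otherwise subtract from a pullback its initial part before
  the first bad exponent \<open>m\<close>, which is a polynomial in \<open>f / g\<close>; multiplying by \<open>g^m\<close> to clear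
  denominators gives a germ whose order is \<open>m\<close> plus a multiple of \<open>d\<close>.
\<close>

lemma pullback_supported_on_multiples:
  assumes \<gamma>: "centered_arc \<gamma>" and t: "t $ 0 = 0" "t $ 1 \<noteq> 0" and d: "d > 0"
    and div: "\<And>s. s \<in> arc_orders \<gamma> \<Longrightarrow> d dvd s"
    and g: "pullback \<gamma> g \<noteq> 0" and fg: "pullback \<gamma> f oo t = fps_X ^ d * (pullback \<gamma> g oo t)"
    and k: "\<not> d dvd k"
  shows "(pullback \<gamma> h oo t) $ k = 0"
proof (rule ccontr)
  define z where "z = pullback \<gamma> h oo t"
  define G where "G = pullback \<gamma> g oo t"
  assume "(pullback \<gamma> h oo t) $ k \<noteq> 0"
  then have ex: "\<not> d dvd k \<and> z $ k \<noteq> 0" using k by (simp add: z_def)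
  define m where "m = (LEAST k. \<not> d dvd k \<and> z $ k \<noteq> 0)"
  have m: "\<not> d dvd m" "z $ m \<noteq> 0"
    using LeastI[of "\<lambda>k. \<not> d dvd k \<and> z $ k \<noteq> 0", OF ex] unfolding m_def by auto
  have least: "z $ i = 0" if "i < m" "\<not> d dvd i" for i
    using not_less_Least[of i "\<lambda>k. \<not> d dvd k \<and> z $ k \<noteq> 0"] that unfolding m_def by blast
  define I where "I = {i. d * i < m}"
  have I: "finite I" "i \<in> I \<Longrightarrow> i \<le> m" for i
  proof -
    have le: "i \<le> m" if "i \<in> I" for i
    proof -
      have "i * 1 \<le> i * d" using d by (intro mult_le_mono2) simp
      also have "i * d < m" using that by (simp add: I_def mult.commute)
      finally show ?thesis by simp
    qed
    then have "I \<subseteq> {..m}" by blast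
    then show "finite I" by (rule finite_subset) simp
    show "i \<in> I \<Longrightarrow> i \<le> m" by (rule le)
  qed
  \<comment> \<open>\<open>E\<close> is \<open>z\<close> without its terms before \<open>m\<close>, which all have exponents \<open>d * i\<close>.\<close>
  define E where "E = z - (\<Sum>i\<in>I. fps_const (z $ (d * i)) * fps_X ^ (d * i))"
  have E_nth: "E $ j = z $ j - (\<Sum>i\<in>I. if j = d * i then z $ (d * i) else 0)" for j
    unfolding E_def by (simp add: fps_sum_nth if_distrib cong: if_cong)
  have Em: "E $ m = z $ m"
    unfolding E_nth by (simp add: I_def sum.neutral)
  have E0: "E $ j = 0" if j: "j < m" for j
  proof (cases "d dvd j")
    case False
    then show ?thesis using least[OF j] by (auto simp: E_nth intro!: sum.neutral)
  next
    case True
    then obtain i0 where i0: "j = d * i0" by blast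
    then have "(\<Sum>i\<in>I. if j = d * i then z $ (d * i) else 0) = (\<Sum>i\<in>I. if i0 = i then z $ j else 0)"
      using d by (intro sum.cong) auto
    also have "\<dots> = z $ j" using I(1) j i0 by (simp add: I_def)
    finally show ?thesis by (simp add: E_nth)
  qed
  have E: "E \<noteq> 0" "subdegree E = m"
    using Em m(2) E0 by (auto intro: subdegreeI)
  define H where "H = g ^ m * h - (\<Sum>i\<in>I. germ_const (z $ (d * i)) * f ^ i * g ^ (m - i))"
  have "pullback \<gamma> H oo t
      = G ^ m * z - (\<Sum>i\<in>I. fps_const (z $ (d * i)) * (fps_X ^ d * G) ^ i * G ^ (m - i))"
    using \<gamma> t(1)
    by (simp add: H_def pullback_diff pullback_sum pullback_mult pullback_power pullback_const z_def G_def
        fps_compose_sub_distrib fps_compose_sum_distrib fps_compose_mult_distrib fg flip: fps_compose_power)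
  also have "(\<Sum>i\<in>I. fps_const (z $ (d * i)) * (fps_X ^ d * G) ^ i * G ^ (m - i))
      = (\<Sum>i\<in>I. G ^ m * (fps_const (z $ (d * i)) * fps_X ^ (d * i)))"
  proof (rule sum.cong[OF refl])
    fix i assume "i \<in> I"
    then have "G ^ m = G ^ i * G ^ (m - i)" using I(2)[of i] by (simp flip: power_add)
    then show "fps_const (z $ (d * i)) * (fps_X ^ d * G) ^ i * G ^ (m - i)
        = G ^ m * (fps_const (z $ (d * i)) * fps_X ^ (d * i))"
      by (simp add: power_mult_distrib power_mult mult_ac)
  qed
  finally have HE: "pullback \<gamma> H oo t = G ^ m * E"
    by (simp add: E_def right_diff_distrib sum_distrib_left)
  have t1: "subdegree t = 1" using t by (intro subdegreeI) auto
  have comp: "subdegree (p oo t) = subdegree p" "p oo t = 0 \<longleftrightarrow> p = 0" for p :: "complex fps"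
    using t t1 by (auto simp: fps_compose_eq_0_iff)
  have G: "G \<noteq> 0" using g by (simp add: G_def comp)
  have "pullback \<gamma> H \<noteq> 0" using HE G E comp(2)[of "pullback \<gamma> H"] by auto
  then have "d dvd subdegree (pullback \<gamma> H)"
    by (intro div) (auto simp: arc_orders_def)
  moreover have "subdegree (pullback \<gamma> H) = m * subdegree (pullback \<gamma> g) + m"
    using HE G E comp(1)[of "pullback \<gamma> H"] comp(1)[of "pullback \<gamma> g"] by (simp add: G_def)
  moreover have "d dvd subdegree (pullback \<gamma> g)"
    using g by (intro div) (auto simp: arc_orders_def)
  ultimately have "d dvd m" by (metis dvd_add_right_iff dvd_mult)
  with m(1) show False by contradiction
qed

theorem arc_orders_cofinite:
  assumes \<gamma>: "primitive_arc \<gamma>"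
  shows "\<exists>c. \<forall>n\<ge>c. n \<in> arc_orders \<gamma>"
proof -
  have conv: "convergent_arc \<gamma>" and cent: "centered_arc \<gamma>"
    using \<gamma> by (auto simp: primitive_arc_def)
  note monoid = arc_orders_0[OF cent] arc_orders_add[OF cent]
  have pos: "\<exists>s\<in>arc_orders \<gamma>. s > 0"
  proof -
    obtain h where h: "pullback \<gamma> h \<noteq> 0" "pullback \<gamma> h $ 0 = 0"
    proof (cases "fst \<gamma> = 0")
      case True
      then show ?thesis
        using that[of germ_y] primitive_arc_nonzero[OF \<gamma>] pullback_y[OF cent] cent
        by (simp add: centered_arc_def)
    next
      case False
      then show ?thesis
        using that[of germ_x] pullback_x[OF cent] cent by (simp add: centered_arc_def)
    qed
    then have "subdegree (pullback \<gamma> h) \<noteq> 0" using nth_subdegree_nonzero[OF h(1)] by metis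
    then have "subdegree (pullback \<gamma> h) > 0" by simp
    with h show ?thesis unfolding arc_orders_def by blast
  qed
  obtain a d where d: "d > 0" and a: "a \<in> arc_orders \<gamma>" "a + d \<in> arc_orders \<gamma>"
    and dvd: "\<And>s. s \<in> arc_orders \<gamma> \<Longrightarrow> d dvd s"
    by (rule additive_monoid_minimal_gap[OF monoid(1) _ pos], erule (1) monoid(2), rule that)
  have "d = 1"
  proof (rule ccontr)
    assume "d \<noteq> 1"
    obtain f0 g0 where "pullback \<gamma> f0 \<noteq> 0" "subdegree (pullback \<gamma> f0) = a + d"
      "pullback \<gamma> g0 \<noteq> 0" "subdegree (pullback \<gamma> g0) = a"
      using a unfolding arc_orders_def by auto
    then obtain f g where
      f: "fps_conv_radius (pullback \<gamma> f) > 0" "pullback \<gamma> f \<noteq> 0" "subdegree (pullback \<gamma> f) = a + d" and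
      g: "fps_conv_radius (pullback \<gamma> g) > 0" "pullback \<gamma> g \<noteq> 0" "subdegree (pullback \<gamma> g) = a"
      using convergent_pullback_same_order[OF conv cent] by metis
    \<comment> \<open>A quotient of order exactly \<open>d\<close>; it need not be the pullback of a germ.\<close>
    define u where "u = pullback \<gamma> f / pullback \<gamma> g"
    have "pullback \<gamma> g dvd pullback \<gamma> f" using f g by (simp add: fps_dvd_iff)
    then have ug: "u * pullback \<gamma> g = pullback \<gamma> f" by (simp add: u_def)
    then have u0: "u \<noteq> 0" using f by auto
    have sub: "subdegree u = d" using arg_cong[OF ug, of subdegree] u0 f g by simp
    have u1: "u $ 0 = 0" using sub d by (metis nth_less_subdegree_zero)
    have "fps_conv_radius u > 0"
      using has_fps_expansion_divide[OF eval_fps_has_fps_expansion[OF f(1)] eval_fps_has_fps_expansion[OF g(1)]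
          _ g(2) refl] f g by (simp add: u_def has_fps_expansion_def)
    then obtain t where t: "fps_conv_radius t > 0" "t $ 0 = 0" "t $ 1 \<noteq> 0" "u oo t = fps_X ^ d"
      using fps_normalizing_parameter[OF _ u0 u1] sub by metis
    obtain z :: complex where z: "\<And>k. z ^ k = 1 \<longleftrightarrow> d dvd k"
      using primitive_root_of_unity_exists[OF d] by metis
    have "pullback \<gamma> f oo t = fps_X ^ d * (pullback \<gamma> g oo t)"
      using t by (simp add: fps_compose_mult_distrib flip: ug)
    from pullback_supported_on_multiples[OF cent t(2,3) d dvd g(2) this]
    have mult: "(pullback \<gamma> h oo t) $ k = 0" if "\<not> d dvd k" for h k using that by blast
    have rot: "fps_rotate z (pullback \<gamma> h oo t) = fps_rotate 1 (pullback \<gamma> h oo t)" for h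
    proof (rule fps_ext)
      fix k
      show "fps_rotate z (pullback \<gamma> h oo t) $ k = fps_rotate 1 (pullback \<gamma> h oo t) $ k"
        using mult[of k h] z[of k] by (cases "d dvd k") (auto simp: fps_compose_linear)
    qed
    have "z = 1"
      using primitive_arc_rotate_inj[OF \<gamma> t(1-3), of z 1] rot[of germ_x] rot[of germ_y]
        pullback_x[OF cent] pullback_y[OF cent] by simp
    then show False using z[of 1] \<open>d \<noteq> 1\<close> by simp
  qed
  with a have "a \<in> arc_orders \<gamma>" "Suc a \<in> arc_orders \<gamma>" by auto
  with additive_monoid_consecutive[OF monoid] show ?thesis by blast
qed

section \<open>The germs vanishing on a branch\<close>

lemma not_unit_germ_of_nth_0:
  assumes "series Q $ 0 $ 0 = 0"
  shows "\<not> Q dvd 1"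
proof
  assume "Q dvd 1"
  then obtain h where "1 = Q * h" by blast
  then have "series 1 $ 0 $ 0 = series (Q * h) $ 0 $ 0" by simp
  then show False using assms by (simp add: one_germ.rep_eq times_germ.rep_eq fps_mult_nth)
qed

lemma germ_x_dvd:
  assumes "series g $ 0 = 0"
  shows "germ_x dvd g"
proof
  obtain M R where M: "0 \<le> M" "1 \<le> R" "\<And>S i j. R \<le> S \<Longrightarrow> norm (series g $ i $ j) \<le> M * S ^ (i + j)"
    using conv2_obtain[of "series g"] series[of g] by auto
  have "conv2 (fps_shift 1 (series g))"
    unfolding conv2_iff_bound
  proof (intro exI conjI allI)
    show "0 < R" using M by simp
    show "norm (fps_shift 1 (series g) $ i $ j) \<le> (M * R) * R ^ (i + j)" for i j
      using M(3)[of R "Suc i" j] by (simp add: mult.assoc)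
  qed
  then have h: "series (Germ (fps_shift 1 (series g))) = fps_shift 1 (series g)"
    by (intro Germ_inverse) simp
  have "series g = fps_X * fps_shift 1 (series g)"
    using assms by (simp add: fps_eq_iff)
  then show "g = germ_x * Germ (fps_shift 1 (series g))"
    by (simp add: series_inject[symmetric] times_germ.rep_eq germ_x.rep_eq h[unfolded One_nat_def])
qed

lemma fps_compose_eq_subst_outer: "p oo x = fps_subst_outer x (Abs_fps (\<lambda>m. fps_const (p $ m)))"
  by (simp add: fps_eq_iff fps_compose_nth fps_subst_outer_def atLeast0AtMost)

lemma fps_subst2_bounded_degree:
  assumes \<gamma>: "centered_arc \<gamma>" and F: "\<And>m j. N \<le> j \<Longrightarrow> F $ m $ j = 0"
  shows "fps_subst2 \<gamma> F = (\<Sum>j<N. (Abs_fps (\<lambda>m. F $ m $ j) oo fst \<gamma>) * snd \<gamma> ^ j)"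
proof -
  have sum: "fps_subst2 \<gamma> (\<Sum>j\<in>J. G j) = (\<Sum>j\<in>J. fps_subst2 \<gamma> (G j))" for J :: "nat set" and G
    by (induction J rule: infinite_finite_induct)
      (simp_all add: fps_subst2_add fps_subst2_const[of _ 0, simplified])
  define c where "c = (\<lambda>j. Abs_fps (\<lambda>m. fps_const (F $ m $ j)))"
  have "F = (\<Sum>j<N. c j * fps_const (fps_X ^ j))"
  proof (intro fps_ext)
    fix m k
    have "(\<Sum>j<N. c j * fps_const (fps_X ^ j)) $ m $ k = (\<Sum>j<N. if j = k then F $ m $ k else 0)"
      unfolding fps_sum_nth by (intro sum.cong) (auto simp: c_def)
    then show "F $ m $ k = (\<Sum>j<N. c j * fps_const (fps_X ^ j)) $ m $ k"
      using F[of k m] by simp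
  qed
  then have "fps_subst2 \<gamma> F = (\<Sum>j<N. fps_subst2 \<gamma> (c j) * fps_subst2 \<gamma> (fps_const (fps_X ^ j)))"
    by (metis (no_types, lifting) sum fps_subst2_mult[OF \<gamma>] sum.cong)
  also have "\<dots> = (\<Sum>j<N. (Abs_fps (\<lambda>m. F $ m $ j) oo fst \<gamma>) * snd \<gamma> ^ j)"
  proof (rule sum.cong[OF refl])
    fix j
    have "fps_subst2 \<gamma> (c j) = Abs_fps (\<lambda>m. F $ m $ j) oo fst \<gamma>"
      by (simp add: fps_subst2_def c_def fps_compose_eq_subst_outer[of _ "fst \<gamma>"])
    then show "fps_subst2 \<gamma> (c j) * fps_subst2 \<gamma> (fps_const (fps_X ^ j))
        = (Abs_fps (\<lambda>m. F $ m $ j) oo fst \<gamma>) * snd \<gamma> ^ j"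
      using \<gamma> by (simp add: fps_subst2_const centered_arc_def fps_X_power_compose)
  qed
  finally show ?thesis .
qed

lemma coeff_linear_factor_mult:
  "coeff ([:- b, 1:] * p) j = (case j of 0 \<Rightarrow> 0 | Suc k \<Rightarrow> coeff p k) - b * coeff p j"
  for b :: "'a::comm_ring_1"
  by (simp add: coeff_pCons split: nat.split)

text \<open>
  The coefficients are symmetric functions of the roots, so they are compatible with ring homomorphisms.
  Rotation of the parameter and evaluation at \<open>0\<close> are the homomorphisms of interest.
\<close>

lemma coeff_prod_linear_factors_hom:
  fixes b :: "'i \<Rightarrow> 'a::comm_ring_1" and \<phi> :: "'a \<Rightarrow> 'b::comm_ring_1"
  assumes "\<phi> 0 = 0" "\<phi> 1 = 1" "\<And>x y. \<phi> (x - y) = \<phi> x - \<phi> y" "\<And>x y. \<phi> (x * y) = \<phi> x * \<phi> y"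
  shows "\<phi> (coeff (\<Prod>i\<in>I. [:- b i, 1:]) j) = coeff (\<Prod>i\<in>I. [:- \<phi> (b i), 1:]) j"
proof (induction I arbitrary: j rule: infinite_finite_induct)
  case (insert i I)
  show ?case
    unfolding prod.insert[OF insert(1,2)] coeff_linear_factor_mult
    using insert assms by (auto split: nat.split)
qed (simp_all add: assms)

lemma coeff_prod_linear_factors_closed:
  fixes b :: "'i \<Rightarrow> 'a::comm_ring_1"
  assumes "0 \<in> A" "1 \<in> A" "\<And>x y. x \<in> A \<Longrightarrow> y \<in> A \<Longrightarrow> x - y \<in> A" "\<And>x y. x \<in> A \<Longrightarrow> y \<in> A \<Longrightarrow> x * y \<in> A"
    and b: "\<And>i. i \<in> I \<Longrightarrow> b i \<in> A"
  shows "coeff (\<Prod>i\<in>I. [:- b i, 1:]) j \<in> A"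
  using b
proof (induction I arbitrary: j rule: infinite_finite_induct)
  case (insert i I)
  show ?case
    unfolding prod.insert[OF insert(1,2)] coeff_linear_factor_mult
    using insert assms(1-4) by (auto split: nat.split)
qed (use assms in auto)

lemma fps_conv_radius_imp_geometric_bound:
  fixes p :: "complex fps"
  assumes "fps_conv_radius p > 0"
  obtains A S where "0 \<le> A" "1 \<le> S" "\<And>k. norm (p $ k) \<le> A * S ^ k"
proof -
  obtain r :: real where r: "0 < ereal r" "ereal r < fps_conv_radius p"
    using ereal_dense2[OF assms] by blast
  then have sum: "summable (\<lambda>k. norm (p $ k * of_real r ^ k))"
    by (intro norm_summable_fps) simp
  define A where "A = suminf (\<lambda>k. norm (p $ k * of_real r ^ k))"
  have A: "norm (p $ k) * r ^ k \<le> A" for k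
    using sum_le_suminf[OF sum, of "{k}"] r by (simp add: A_def norm_mult norm_power)
  have "0 \<le> A" using A[of 0] norm_ge_zero[of "p $ 0"] by (simp del: norm_ge_zero)
  define S where "S = max 1 (1 / r)"
  have "norm (p $ k) \<le> A * S ^ k" for k
  proof -
    have "norm (p $ k) \<le> A * (1 / r) ^ k" using A[of k] r by (simp add: power_divide field_simps)
    also have "\<dots> \<le> A * S ^ k" using \<open>0 \<le> A\<close> r by (intro mult_left_mono power_mono) (auto simp: S_def)
    finally show ?thesis .
  qed
  with \<open>0 \<le> A\<close> show thesis by (intro that[of A S]) (auto simp: S_def)
qed

lemma fps_conv_radius_closed:
  fixes p r :: "complex fps"
  assumes "fps_conv_radius p > 0" "fps_conv_radius r > 0"
  shows "fps_conv_radius (p - r) > 0" "fps_conv_radius (p * r) > 0"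
  using assms
  by (auto intro!: less_le_trans[OF _ fps_conv_radius_diff] less_le_trans[OF _ fps_conv_radius_mult])

text \<open>
  If the first coordinate \<open>x\<close> of the arc is zero, \<open>Q = x\<close> works.  Otherwise reparametrize so that the arc is \<open>(s^n, b(s))\<close> and take for
  \<open>Q\<close> the polynomial in the second variable with the conjugate roots \<open>b(\<zeta>^i s)\<close>; rotation permutes these roots
  cyclically, so the coefficients are series in \<open>s^n\<close>.  The remainder of a vanishing germ on division by
  \<open>Q\<close> has all the conjugates as roots, which are more than its degree allows.
\<close>

theorem vanishing_germs_common_divisor:
  assumes \<gamma>: "primitive_arc \<gamma>"
  obtains Q where "\<not> Q dvd 1" "\<And>g. pullback \<gamma> g = 0 \<Longrightarrow> Q dvd g"
proof (cases "fst \<gamma> = 0")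
  case True
  have cent: "centered_arc \<gamma>" using \<gamma> by (simp add: primitive_arc_def)
  have y: "snd \<gamma> \<noteq> 0" using primitive_arc_nonzero[OF \<gamma>] True by simp
  have "germ_x dvd g" if "pullback \<gamma> g = 0" for g
  proof (rule germ_x_dvd)
    have "fps_subst2 \<gamma> (series g) = series g $ 0 oo snd \<gamma>"
    proof (rule fps_ext)
      fix n
      have "fps_subst2 \<gamma> (series g) $ n = (\<Sum>i\<le>n. if i = 0 then (series g $ 0 oo snd \<gamma>) $ n else 0)"
        unfolding fps_subst2_def fps_subst_outer_def fps_nth_Abs_fps
        by (intro sum.cong) (auto simp: True power_0_left)
      then show "fps_subst2 \<gamma> (series g) $ n = (series g $ 0 oo snd \<gamma>) $ n" by simp
    qed
    then show "series g $ 0 = 0"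
      using that y cent
      by (simp add: pullback_eq_fps_subst2 fps_compose_eq_0_iff centered_arc_def)
  qed
  moreover have "\<not> germ_x dvd 1"
    by (rule not_unit_germ_of_nth_0) (simp add: germ_x.rep_eq)
  ultimately show ?thesis using that by blast
next
  case False
  have cent: "centered_arc \<gamma>" and conv: "convergent_arc \<gamma>"
    using \<gamma> by (auto simp: primitive_arc_def)
  have x0: "fst \<gamma> $ 0 = 0" and y0: "snd \<gamma> $ 0 = 0" using cent by (auto simp: centered_arc_def)
  define n where "n = subdegree (fst \<gamma>)"
  have n: "n > 0" unfolding n_def using x0 False nth_subdegree_nonzero[OF False] by (metis gr0I)
  obtain t where t: "fps_conv_radius t > 0" "t $ 0 = 0" "t $ 1 \<noteq> 0" and xt: "fst \<gamma> oo t = fps_X ^ n"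
    unfolding n_def
    by (rule fps_normalizing_parameter[OF _ False x0]) (use conv in \<open>simp add: convergent_arc_def\<close>)
  define b where "b = snd \<gamma> oo t"
  have b0: "b $ 0 = 0" using y0 by (simp add: b_def)
  have bconv: "fps_conv_radius b > 0"
    using has_fps_expansion_compose[OF eval_fps_has_fps_expansion eval_fps_has_fps_expansion[OF t(1)] t(2),
        of "snd \<gamma>"] conv
    by (simp add: b_def has_fps_expansion_def convergent_arc_def)
  define \<beta> where "\<beta> = (fps_X ^ n :: complex fps, b)"
  have \<beta>: "centered_arc \<beta>" using n b0 by (simp add: \<beta>_def centered_arc_def)
  have subst_\<beta>: "fps_subst2 \<beta> (series g) = pullback \<gamma> g oo t" for g
    using fps_subst2_compose[OF cent t(2), of "series g"]
    by (simp add: pullback_eq_fps_subst2[OF cent] \<beta>_def b_def xt)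
  obtain z :: complex where z: "\<And>k. z ^ k = 1 \<longleftrightarrow> n dvd k"
    using primitive_root_of_unity_exists[OF n] by metis
  define B where "B = (\<lambda>i::nat. fps_rotate (z ^ i) b)"
  have rot_Xn: "fps_rotate (z ^ i) (fps_X ^ n) = fps_X ^ n" for i
  proof -
    have "(z ^ i) ^ n = 1" using z[of "i * n"] by (simp add: power_mult)
    then show ?thesis by (simp add: fps_eq_iff fps_compose_linear)
  qed
  have inj: "inj_on B {..<n}"
  proof (rule linorder_inj_onI)
    fix i j assume ij: "i < j" "i \<in> {..<n}" "j \<in> {..<n}"
    show "B i \<noteq> B j"
    proof
      assume "B i = B j"
      then have "z ^ i = z ^ j"
        using primitive_arc_rotate_inj[OF \<gamma> t, of "z ^ i" "z ^ j"]
        unfolding xt b_def[symmetric] rot_Xn B_def by simp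
      also have "z ^ j = z ^ i * z ^ (j - i)" using ij(1) by (simp flip: power_add)
      finally have "z ^ (j - i) = 1" using z[of 0] z[of n] n by (cases "z = 0") (auto simp: power_0_left)
      then show False using z[of "j - i"] ij by (auto dest: dvd_imp_le)
    qed
  qed auto
  define P where "P = (\<Prod>i<n. [:- B i, 1:])"
  have deg: "degree P = n" and lead: "coeff P n = 1"
  proof -
    show "degree P = n" unfolding P_def by (subst degree_prod_eq_sum_degree) auto
    moreover have "lead_coeff P = 1" unfolding P_def by (simp add: lead_coeff_prod)
    ultimately show "coeff P n = 1" by simp
  qed
  \<comment> \<open>Rotation by \<open>z\<close> shifts the index of the roots by one, and \<open>B n = B 0\<close>.\<close>
  have rot_P: "fps_rotate z (coeff P j) = coeff P j" for j
  proof -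
    have "fps_rotate z (coeff P j) = coeff (\<Prod>i<n. [:- fps_rotate z (B i), 1:]) j"
      unfolding P_def
      by (rule coeff_prod_linear_factors_hom)
        (simp_all add: fps_compose_sub_distrib fps_compose_mult_distrib)
    also have "(\<Prod>i<n. [:- fps_rotate z (B i), 1:]) = (\<Prod>i<n. [:- B (Suc i), 1:])"
      by (intro prod.cong) (auto simp: B_def fps_eq_iff fps_compose_linear power_mult_distrib)
    also have "\<dots> = P"
    proof -
      have Bn: "B n = B 0" using z[of n] by (simp add: B_def)
      have "[:- B 0, 1:] * (\<Prod>i<n. [:- B (Suc i), 1:]) = (\<Prod>i<Suc n. [:- B i, 1:])"
        by (rule prod.lessThan_Suc_shift[symmetric])
      also have "\<dots> = P * [:- B 0, 1:]" unfolding P_def prod.lessThan_Suc Bn ..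
      also have "\<dots> = [:- B 0, 1:] * P" by (rule mult.commute)
      finally show ?thesis unfolding mult_cancel_left by simp
    qed
    finally show ?thesis .
  qed
  have P_support: "coeff P j $ k = 0" if "\<not> n dvd k" for j k
  proof -
    have "z ^ k * coeff P j $ k = coeff P j $ k"
      using arg_cong[OF rot_P[of j], of "\<lambda>p. p $ k"] by (simp add: fps_compose_linear)
    then show ?thesis using z[of k] that by simp
  qed
  have P_0: "coeff P j $ 0 = (if j = n then 1 else 0)" for j
  proof -
    have "coeff P j $ 0 = coeff (\<Prod>i<n. [:- (B i $ 0), 1:]) j"
      unfolding P_def by (rule coeff_prod_linear_factors_hom) simp_all
    also have "(\<Prod>i<n. [:- (B i $ 0), 1:]) = monom 1 n"
      using b0 by (simp add: B_def monom_altdef)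
    finally show ?thesis by simp
  qed
  have P_conv: "fps_conv_radius (coeff P j) > 0" for j
    unfolding P_def
    using coeff_prod_linear_factors_closed[of "{p. fps_conv_radius p > 0}" "{..<n}" B j]
    by (simp add: fps_conv_radius_closed B_def fps_conv_radius_rotate bconv)
  have P_root: "poly P (B i) = 0" if "i < n" for i
    unfolding P_def poly_prod using that by (auto intro!: prod_zero)
  \<comment> \<open>Replace \<open>s^n\<close> by \<open>x\<close>: only exponents divisible by \<open>n\<close> occur in the coefficients of \<open>P\<close>.\<close>
  define Qs where "Qs = Abs_fps (\<lambda>l. Abs_fps (\<lambda>j. coeff P j $ (n * l)))"
  have Qs_nth: "Qs $ l $ j = coeff P j $ (n * l)" for l j by (simp add: Qs_def)
  have "conv2 Qs"
  proof -
    have "\<exists>A S. 0 \<le> A \<and> 1 \<le> S \<and> (\<forall>k. norm (coeff P j $ k) \<le> A * S ^ k)" for j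
      using fps_conv_radius_imp_geometric_bound[OF P_conv[of j]] by metis
    then obtain A S where AS: "\<And>j. 0 \<le> A j" "\<And>j. 1 \<le> S j"
      "\<And>j k. norm (coeff P j $ k) \<le> A j * S j ^ k" by metis
    define A' S' where "A' = (\<Sum>j\<le>n. A j)" and "S' = (\<Sum>j\<le>n. S j)"
    have le: "A j \<le> A'" "S j \<le> S'" if "j \<le> n" for j
      unfolding A'_def S'_def
      by (rule member_le_sum, use that AS in \<open>auto intro: order_trans[OF zero_le_one]\<close>)+
    have S': "1 \<le> S'" using le(2)[of 0] AS(2)[of 0] by simp
    have A': "0 \<le> A'" using le(1)[of 0] AS(1)[of 0] by simp
    show ?thesis unfolding conv2_iff_bound
    proof (intro exI conjI allI)
      show "0 < S' ^ n" using S' by simp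
      fix l j
      show "norm (Qs $ l $ j) \<le> A' * (S' ^ n) ^ (l + j)"
      proof (cases "j \<le> n")
        case True
        have "norm (Qs $ l $ j) \<le> A j * S j ^ (n * l)" by (simp add: Qs_nth AS)
        also have "\<dots> \<le> A' * S' ^ (n * l)"
          using le[OF True] AS(1)[of j] AS(2)[of j] A' by (intro mult_mono power_mono) auto
        also have "\<dots> \<le> A' * S' ^ (n * (l + j))"
          using S' A' by (intro mult_left_mono power_increasing) auto
        finally show ?thesis by (simp add: power_mult)
      next
        case False
        then show ?thesis using A' S' deg by (simp add: Qs_nth coeff_eq_0)
      qed
    qed
  qed
  define Q where "Q = Germ Qs"
  have Q: "series Q = Qs" unfolding Q_def using \<open>conv2 Qs\<close> by (intro Germ_inverse) simp
  have Q0: "series Q $ 0 = fps_X ^ n"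
    by (simp add: fps_eq_iff Q Qs_nth P_0)
  have subst_Q: "fps_subst2 \<beta> (series Q) = 0"
  proof -
    have "Abs_fps (\<lambda>m. series Q $ m $ j) oo fps_X ^ n = coeff P j" for j
      using n P_support by (auto simp: fps_eq_iff fps_nth_compose_X_power Q Qs_nth)
    moreover have "series Q $ m $ j = 0" if "Suc n \<le> j" for m j
      using that deg by (simp add: Q Qs_nth coeff_eq_0)
    ultimately have "fps_subst2 \<beta> (series Q) = (\<Sum>j<Suc n. coeff P j * b ^ j)"
      using fps_subst2_bounded_degree[OF \<beta>, of "Suc n" "series Q"] by (simp add: \<beta>_def)
    also have "\<dots> = poly P b" by (simp add: poly_altdef deg lessThan_Suc_atMost)
    also have "b = B 0" by (simp add: B_def)
    finally show ?thesis using P_root[of 0] n by simp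
  qed
  have "Q dvd g" if g: "pullback \<gamma> g = 0" for g
  proof -
    obtain h where h: "\<And>m j. n \<le> j \<Longrightarrow> series (g - Q * h) $ m $ j = 0"
      using weierstrass_division[OF Q0] by blast
    define r where "r = series (g - Q * h)"
    define R where "R = (\<lambda>j. Abs_fps (\<lambda>m. r $ m $ j))"
    define T where "T = (\<Sum>j<n. monom (R j oo fps_X ^ n) j)"
    have "series g = r + series Q * series h"
      by (simp add: r_def minus_germ.rep_eq times_germ.rep_eq)
    then have "fps_subst2 \<beta> r = 0"
      using subst_\<beta>[of g] g subst_Q fps_subst2_mult[OF \<beta>, of "series Q" "series h"]
        fps_subst2_add[of \<beta> r "series Q * series h"] by simp
    moreover have "fps_subst2 \<beta> r = (\<Sum>j<n. (R j oo fps_X ^ n) * b ^ j)"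
      using fps_subst2_bounded_degree[OF \<beta>, of n r] h by (simp add: \<beta>_def R_def r_def)
    ultimately have root: "(\<Sum>j<n. (R j oo fps_X ^ n) * b ^ j) = 0" by simp
    have rot_R: "fps_rotate (z ^ i) (R j oo fps_X ^ n) = R j oo fps_X ^ n" for i j
      using n rot_Xn[of i] by (simp add: fps_compose_assoc[symmetric])
    have "poly T (B i) = 0" for i
    proof -
      have "poly T (B i) = fps_rotate (z ^ i) (\<Sum>j<n. (R j oo fps_X ^ n) * b ^ j)"
        by (simp add: T_def poly_sum poly_monom fps_compose_sum_distrib fps_compose_mult_distrib rot_R B_def
            fps_compose_power)
      then show ?thesis by (simp add: root)
    qed
    then have roots: "B ` {..<n} \<subseteq> {p. poly T p = 0}" by blast
    have "T = 0"
    proof (rule ccontr)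
      assume T: "T \<noteq> 0"
      have "n = card (B ` {..<n})" using inj by (simp add: card_image)
      also have "\<dots> \<le> card {p. poly T p = 0}"
        using roots T by (intro card_mono poly_roots_finite) auto
      also have "\<dots> \<le> degree T" using T by (rule card_poly_roots_bound)
      also have "degree T \<le> n - 1"
        unfolding T_def by (intro degree_sum_le) (auto intro: order_trans[OF degree_monom_le])
      finally show False using n by simp
    qed
    then have "R j oo fps_X ^ n = 0" if "j < n" for j
    proof -
      have "coeff T j = R j oo fps_X ^ n" using that by (simp add: T_def coeff_sum)
      then show ?thesis using \<open>T = 0\<close> by simp
    qed
    then have "R j = 0" if "j < n" for j
      using that n by (simp add: fps_compose_eq_0_iff)
    then have "r $ m $ j = 0" for m j
      using h[of j m] by (cases "j < n") (auto simp: R_def r_def fps_eq_iff)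
    then have "series (g - Q * h) = series 0"
      by (simp add: fps_eq_iff r_def zero_germ.rep_eq)
    then show ?thesis by (auto simp: series_inject)
  qed
  moreover have "\<not> Q dvd 1"
    by (rule not_unit_germ_of_nth_0) (use n in \<open>simp add: Q0\<close>)
  ultimately show ?thesis using that by blast
qed

section \<open>The Hilbert function of a curve\<close>

lemma enat_le_valuation_iff:
  "enat m \<le> valuation \<gamma> f \<longleftrightarrow> (\<forall>i<m. pullback \<gamma> f $ i = 0)"
proof (cases "pullback \<gamma> f = 0")
  case False
  then have "m \<le> subdegree (pullback \<gamma> f) \<longleftrightarrow> (\<forall>i<m. pullback \<gamma> f $ i = 0)"
    by (metis less_le_trans nth_less_subdegree_zero nth_subdegree_nonzero not_le)
  with False show ?thesis by (simp add: valuation_def)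
qed (simp add: valuation_def)

lemma J_ideal_eq: "J_ideal \<gamma> v = {f. \<forall>k. \<forall>i<nat (v k). pullback (\<gamma> k) f $ i = 0}"
  by (simp add: J_ideal_def enat_le_valuation_iff)

lemma subspace_J_ideal:
  assumes "\<And>k. centered_arc (\<gamma> k)"
  shows "germ.subspace (J_ideal \<gamma> v)"
  using assms by (auto simp: germ.subspace_def J_ideal_eq pullback_0 pullback_add pullback_scale)

lemma J_ideal_add_unit_vec:
  assumes "0 \<le> v k"
  shows "J_ideal \<gamma> (v + unit_vec k) = {f \<in> J_ideal \<gamma> v. pullback (\<gamma> k) f $ nat (v k) = 0}"
proof -
  have "nat ((v + unit_vec k) j) = (if j = k then Suc (nat (v k)) else nat (v j))" for j
    using assms by (simp add: unit_vec_def nat_add_distrib)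
  then show ?thesis
    by (auto simp: J_ideal_eq less_Suc_eq simp del: plus_fun_apply split: if_splits)
qed

lemma quotient_basis_J_ideal_add_unit_vec:
  assumes \<gamma>: "\<And>k. centered_arc (\<gamma> k)" and v: "0 \<le> v k"
    and B: "quotient_basis (J_ideal \<gamma> v) B"
    and g: "g \<in> J_ideal \<gamma> v" "pullback (\<gamma> k) g $ nat (v k) \<noteq> 0"
  shows "quotient_basis (J_ideal \<gamma> (v + unit_vec k)) (insert g B)" "g \<notin> B"
proof -
  note step = J_ideal_add_unit_vec[where v = v and k = k and \<gamma> = \<gamma>, OF v]
  have sub: "J_ideal \<gamma> (v + unit_vec k) \<subseteq> J_ideal \<gamma> v" and new: "g \<notin> J_ideal \<gamma> (v + unit_vec k)"
    using g(2) unfolding step by auto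
  have line: "\<exists>c. f - germ_scale c g \<in> J_ideal \<gamma> (v + unit_vec k)" if f: "f \<in> J_ideal \<gamma> v" for f
  proof -
    define c where "c = pullback (\<gamma> k) f $ nat (v k) / pullback (\<gamma> k) g $ nat (v k)"
    have "f - germ_scale c g \<in> J_ideal \<gamma> v"
      using f g(1) subspace_J_ideal[OF \<gamma>] by (intro germ.subspace_diff germ.subspace_scale) auto
    moreover have "pullback (\<gamma> k) (f - germ_scale c g) $ nat (v k) = 0"
      using g(2) by (simp add: pullback_diff[OF \<gamma>] pullback_scale[OF \<gamma>] c_def)
    ultimately show ?thesis unfolding step by blast
  qed
  show "quotient_basis (J_ideal \<gamma> (v + unit_vec k)) (insert g B)" "g \<notin> B"
    by (rule quotient_basis_insert[OF B subspace_J_ideal[OF \<gamma>] subspace_J_ideal[OF \<gamma>] sub g(1) new line], assumption)+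
qed

text \<open>
  Raising one coordinate of \<open>v\<close> by one imposes at most one linear condition, so a finite basis can be built up
  from \<open>J_ideal \<gamma> 0 = UNIV\<close>.
\<close>

lemma finite_quotient_basis_J_ideal:
  fixes \<gamma> :: "'r::finite \<Rightarrow> arc"
  assumes \<gamma>: "\<And>k. centered_arc (\<gamma> k)"
  shows "\<exists>B. finite B \<and> quotient_basis (J_ideal \<gamma> v) B"
proof (induction "\<Sum>k\<in>UNIV. nat (v k)" arbitrary: v rule: less_induct)
  case less
  show ?case
  proof (cases "\<exists>k. 0 < v k")
    case False
    then have "J_ideal \<gamma> v = UNIV" by (auto simp: J_ideal_eq not_less)
    then show ?thesis using quotient_basis_UNIV by (intro exI[of _ "{}"]) simp
  next
    case True
    then obtain k where k: "0 < v k" by blast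
    define w where "w = v - unit_vec k"
    have w: "v = w + unit_vec k" "0 \<le> w k" using k by (auto simp: w_def unit_vec_def)
    have "(\<Sum>k\<in>UNIV. nat (w k)) < (\<Sum>k\<in>UNIV. nat (v k))"
      by (rule sum_strict_mono_ex1) (use k in \<open>auto simp: w_def unit_vec_def intro!: exI[of _ k]\<close>)
    from less[OF this] obtain B where B: "finite B" "quotient_basis (J_ideal \<gamma> w) B" by blast
    show ?thesis
    proof (cases "\<exists>g\<in>J_ideal \<gamma> w. pullback (\<gamma> k) g $ nat (w k) \<noteq> 0")
      case True
      then obtain g where "g \<in> J_ideal \<gamma> w" "pullback (\<gamma> k) g $ nat (w k) \<noteq> 0" by blast
      from quotient_basis_J_ideal_add_unit_vec(1)[where v = w and k = k and \<gamma> = \<gamma>, OF \<gamma> w(2) B(2) this] B(1) w(1)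
      show ?thesis by (metis finite_insert)
    next
      case False
      then have "J_ideal \<gamma> v = J_ideal \<gamma> w"
        unfolding w(1) J_ideal_add_unit_vec[where v = w and k = k and \<gamma> = \<gamma>, OF w(2)] by blast
      with B show ?thesis by auto
    qed
  qed
qed

lemma codim_fun_step:
  fixes \<gamma> :: "'r::finite \<Rightarrow> arc"
  assumes \<gamma>: "\<And>k. centered_arc (\<gamma> k)" and v: "0 \<le> v k"
    and g: "g \<in> J_ideal \<gamma> v" "pullback (\<gamma> k) g $ nat (v k) \<noteq> 0"
  shows "codim_fun \<gamma> (v + unit_vec k) = codim_fun \<gamma> v + 1"
proof -
  obtain B where B: "finite B" "quotient_basis (J_ideal \<gamma> v) B"
    using finite_quotient_basis_J_ideal[where \<gamma> = \<gamma> and v = v] \<gamma> by blast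
  note ins = quotient_basis_J_ideal_add_unit_vec[where v = v and k = k and \<gamma> = \<gamma>, OF \<gamma> v B(2) g]
  have "codim_fun \<gamma> v = card B"
    unfolding codim_fun_def by (rule quotient_dim_eq_card[OF B(2,1) subspace_J_ideal[OF \<gamma>]])
  moreover have "codim_fun \<gamma> (v + unit_vec k) = card (insert g B)"
    unfolding codim_fun_def
    by (rule quotient_dim_eq_card[OF ins(1) _ subspace_J_ideal[OF \<gamma>]]) (simp add: B)
  ultimately show ?thesis using ins(2) B(1) by simp
qed

text \<open>
  Multiplying \<open>G\<close> by germs of all large orders on the branch \<open>k\<close> gives germs of every large order there
  that vanish on the other branches; this is why the bound does not depend on the other coordinates of \<open>v\<close>.
\<close>

lemma codim_fun_eventually_step:
  fixes \<gamma> :: "'r::finite \<Rightarrow> arc"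
  assumes \<gamma>: "\<And>k. primitive_arc (\<gamma> k)"
    and G: "pullback (\<gamma> k) G \<noteq> 0" "\<And>j. j \<noteq> k \<Longrightarrow> pullback (\<gamma> j) G = 0"
  shows "\<exists>c. \<forall>v. c \<le> v k \<longrightarrow> codim_fun \<gamma> (v + unit_vec k) = codim_fun \<gamma> v + 1"
proof -
  have cent: "centered_arc (\<gamma> j)" for j using \<gamma> by (simp add: primitive_arc_def)
  obtain N where N: "\<And>n. N \<le> n \<Longrightarrow> n \<in> arc_orders (\<gamma> k)"
    using arc_orders_cofinite[OF \<gamma>[of k]] by blast
  define m where "m = subdegree (pullback (\<gamma> k) G)"
  have "codim_fun \<gamma> (v + unit_vec k) = codim_fun \<gamma> v + 1" if v: "int (m + N) \<le> v k" for v
  proof -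
    define n where "n = nat (v k) - m"
    have n: "N \<le> n" "nat (v k) = m + n" using v by (auto simp: n_def)
    obtain f where f: "pullback (\<gamma> k) f \<noteq> 0" "subdegree (pullback (\<gamma> k) f) = n"
      using N[OF n(1)] unfolding arc_orders_def by auto
    have pb: "pullback (\<gamma> j) (G * f) = pullback (\<gamma> j) G * pullback (\<gamma> j) f" for j
      by (rule pullback_mult[OF cent])
    have nz: "pullback (\<gamma> k) (G * f) \<noteq> 0" and ord: "subdegree (pullback (\<gamma> k) (G * f)) = nat (v k)"
      using f G(1) n(2) by (auto simp: pb m_def)
    have "G * f \<in> J_ideal \<gamma> v"
      unfolding J_ideal_eq
    proof (clarify)
      fix j i assume i: "i < nat (v j)"
      show "pullback (\<gamma> j) (G * f) $ i = 0"
      proof (cases "j = k")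
        case True
        with i ord show ?thesis by (metis nth_less_subdegree_zero)
      next
        case False
        then show ?thesis by (simp add: pb G(2))
      qed
    qed
    moreover have "pullback (\<gamma> k) (G * f) $ nat (v k) \<noteq> 0"
      using nz by (simp flip: ord)
    ultimately show ?thesis
      using v by (intro codim_fun_step[where v = v and k = k and \<gamma> = \<gamma>, OF cent]) simp_all
  qed
  then show ?thesis by blast
qed

lemma pullback_distinct_component_nonzero:
  fixes F :: "'r::finite \<Rightarrow> germ"
  assumes "squarefree (\<Prod>k\<in>UNIV. F k)" and unif: "\<And>k. uniformization (F k) (\<gamma> k)" and "j \<noteq> k"
  shows "pullback (\<gamma> k) (F j) \<noteq> 0"
proof
  assume "pullback (\<gamma> k) (F j) = 0"
  obtain Q where Q: "\<not> Q dvd 1" "\<And>g. pullback (\<gamma> k) g = 0 \<Longrightarrow> Q dvd g"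
    by (rule vanishing_germs_common_divisor[OF uniformization_imp_primitive_arc[OF unif[of k]]]) (rule that)
  have "Q dvd F j" "Q dvd F k"
    using Q(2) uniformization_pullback_eq_0[OF unif[of k]] \<open>pullback (\<gamma> k) (F j) = 0\<close> by blast+
  then have "Q ^ 2 dvd F j * F k" unfolding power2_eq_square by (rule mult_dvd_mono)
  also have "F j * F k = (\<Prod>i\<in>{j, k}. F i)" using \<open>j \<noteq> k\<close> by simp
  also have "\<dots> dvd (\<Prod>i\<in>UNIV. F i)" by (rule prod_dvd_prod_subset) auto
  finally have "Q dvd 1" using assms(1) by (rule squarefreeD[rotated])
  with Q(1) show False by contradiction
qed

theorem corollary1:
  fixes f :: germ and F :: "'r::finite \<Rightarrow> germ" and \<gamma> :: "'r \<Rightarrow> arc"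
  assumes "squarefree f"
    and "f = (\<Prod>k\<in>UNIV. F k)"
    and "\<And>k. irreducible (F k)"
    and "\<And>k. uniformization (F k) (\<gamma> k)"
  shows "is_polynomial (reduced_poincare_series \<gamma>)"
proof -
  have prim: "primitive_arc (\<gamma> k)" for k
    using assms(4) by (rule uniformization_imp_primitive_arc)
  have cent: "centered_arc (\<gamma> k)" for k using prim by (simp add: primitive_arc_def)
  have "\<exists>c. \<forall>v. c \<le> v k \<longrightarrow> codim_fun \<gamma> (v + unit_vec k) = codim_fun \<gamma> v + 1" for k
  proof (rule codim_fun_eventually_step[OF prim])
    show "pullback (\<gamma> k) (\<Prod>j\<in>UNIV-{k}. F j) \<noteq> 0"
      using pullback_distinct_component_nonzero[of F \<gamma>] assms by (auto simp: pullback_prod[OF cent])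
    show "pullback (\<gamma> j) (\<Prod>j\<in>UNIV-{k}. F j) = 0" if "j \<noteq> k" for j
      using that uniformization_pullback_eq_0[OF assms(4)[of j]]
      by (auto simp: pullback_prod[OF cent] intro!: prod_zero)
  qed
  then obtain c where "\<And>k v. c k \<le> v k \<Longrightarrow> codim_fun \<gamma> (v + unit_vec k) = codim_fun \<gamma> v + 1"
    by metis
  then show ?thesis by (rule reduced_poincare_series_polynomial)
qed

end
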